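(* (FouT) For the FouT system $$\bm A_{nk}=\begin{cases}-2&n=k=0\\-2\sqrt2&n=0,\ k\text{ odd}\\-2\sqrt2&k=0,\ n\text{ odd}\\-4&n,k\text{ odd}\\ 2\pi\frac{k+1}{2}&n-k=1,\ k\text{ odd}\\-2\pi\frac{n+1}{2}&k-n=1,\ n\text{ odd}\\0&\text{otherwise}\end{cases}\qquad \bm B_n=\begin{cases}2&n=0\\2\sqrt2&n\text{ odd}\\0&\text{otherwise}\end{cases}$$ let $\bm C$ be twice the vector of evaluations of the basis functions, $\bm C_n=2\cdot p_n(1)$, where $(p_n)_{n\ge0}=(1,\sqrt2\cos(2\pi t),\sqrt2\sin(2\pi t),\sqrt2\cos(4\pi t),\sqrt2\sin(4\pi t),\dots)$, and let $\bm D=-1$. (LegT) For the LegT system $$\bm A_{nk}=-(2n+1)^{1/2}(2k+1)^{1/2}\cdot\begin{cases}1&k\le n\\(-1)^{n-k}&k\ge n\end{cases}\qquad \bm B_n=(2n+1)^{1/2}$$ let $\bm C$ be the vector of evaluations of the basis functions, $\bm C_n=p_n(1)=(1+2n)^{1/2}(-1)^n$, and let $\bm D=0$. Then, in each of the two cases, the SSM kernel $K(t)=\bm Ce^{t\bm A}\bm B+\bm D\,\delta(t)$ limits to $K(t)\to\delta(t-1)$ as $N\to\infty$.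
   Context: Here $N$ is the state size: $\bm A\in\mathbb R^{N\times N}$, $\bm B\in\mathbb R^N$, $\bm C$ is a row vector of length $N$, and indices $n,k$ run from $0$ to $N-1$. The kernel $K$ is the impulse response of the time-invariant state space model $x'(t)=\bm Ax(t)+\bm Bu(t)$, $y(t)=\bm Cx(t)+\bm Du(t)$, i.e. $y=K*u$. $\delta$ is the Dirac delta. In the LegT case $p_n$ are the Legendre polynomials rescaled to be orthonormal on $[0,1]$, with sign such that $p_n(0)=(2n+1)^{1/2}$.
   Formalization: In the FouT case the limit is taken along odd state sizes N = 2m+1 only; for even N the last cosine has no sine partner and the kernel tends to a limit other than δ(t−1), so the claim over all N is false. *)

theory Defs
  imports "HOL-Analysis.Analysis" "Jordan_Normal_Form.Matrix"
begin

(* HOL-Analysis and Jordan_Normal_Form clash on these. The state size varies with the limit, so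
   vectors and matrices are those of Jordan_Normal_Form throughout. *)
unbundle no vec_syntax
hide_const (open) Finite_Cartesian_Product.vec
hide_type (open) Finite_Cartesian_Product.vec

section \<open>Distributions on the real line\<close>

definition test_function :: "(real \<Rightarrow> real) \<Rightarrow> bool" where
  "test_function \<phi> \<longleftrightarrow>
     (\<forall>k x. (deriv ^^ k) \<phi> field_differentiable (at x)) \<and> compact (closure {x. \<phi> x \<noteq> 0})"

text \<open>A distribution is represented by its pairing with test functions. Its values on functions
  that are not test functions carry no meaning and are never looked at.\<close>

type_synonym distribution = "(real \<Rightarrow> real) \<Rightarrow> real"

definition dirac :: "real \<Rightarrow> distribution" where
  "dirac a \<phi> = \<phi> a"

definition distr_tendsto :: "(nat \<Rightarrow> distribution) \<Rightarrow> distribution \<Rightarrow> bool" where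
  "distr_tendsto T L \<longleftrightarrow> (\<forall>\<phi>. test_function \<phi> \<longrightarrow> (\<lambda>j. T j \<phi>) \<longlonglongrightarrow> L \<phi>)"


section \<open>Kernels of state space models\<close>

definition mat_exp :: "real mat \<Rightarrow> real mat" where
  "mat_exp A = mat (dim_row A) (dim_row A) (\<lambda>(i, j). \<Sum>k. (A ^\<^sub>m k) $$ (i, j) / fact k)"

text \<open>The kernel \<open>K(t) = C exp(tA) B + D \<delta>(t)\<close> is the impulse response of a causal system: the
  function part lives on \<open>t \<ge> 0\<close>, and \<open>\<delta>\<close> has its full mass at \<open>0\<close> (so that the feedthrough term
  of \<open>K * u\<close> is \<open>D u\<close>). The row vector \<open>C\<close> enters through the scalar product.\<close>

definition ssm_kernel :: "real mat \<Rightarrow> real vec \<Rightarrow> real vec \<Rightarrow> real \<Rightarrow> distribution" where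
  "ssm_kernel A B C D \<phi> =
     (LBINT t:{0..}. (C \<bullet> (mat_exp (t \<cdot>\<^sub>m A) *\<^sub>v B)) * \<phi> t) + D * dirac 0 \<phi>"


section \<open>The truncated Fourier system\<close>

definition fout_A :: "nat \<Rightarrow> real mat" where
  "fout_A N = mat N N (\<lambda>(n, k).
     if n = 0 \<and> k = 0 then -2
     else if n = 0 \<and> odd k then -2 * sqrt 2
     else if k = 0 \<and> odd n then -2 * sqrt 2
     else if odd n \<and> odd k then -4
     else if n = k + 1 \<and> odd k then 2 * pi * ((real k + 1) / 2)
     else if k = n + 1 \<and> odd n then -2 * pi * ((real n + 1) / 2)
     else 0)"

definition fout_B :: "nat \<Rightarrow> real vec" where
  "fout_B N = vec N (\<lambda>n. if n = 0 then 2 else if odd n then 2 * sqrt 2 else 0)"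

definition fout_basis :: "nat \<Rightarrow> real \<Rightarrow> real" where
  "fout_basis n t =
     (if n = 0 then 1
      else if odd n then sqrt 2 * cos (2 * pi * ((real n + 1) / 2) * t)
      else sqrt 2 * sin (2 * pi * (real n / 2) * t))"

definition fout_C :: "nat \<Rightarrow> real vec" where
  "fout_C N = vec N (\<lambda>n. 2 * fout_basis n 1)"


section \<open>The translated Legendre system\<close>

text \<open>The Legendre polynomial \<open>P\<^sub>n\<close> on \<open>[-1,1]\<close>, by Rodrigues' formula.\<close>

definition legendre :: "nat \<Rightarrow> real \<Rightarrow> real" where
  "legendre n x = poly ((pderiv ^^ n) ([:-1, 0, 1:] ^ n)) x / (2 ^ n * fact n)"

text \<open>Orthonormal on \<open>[0,1]\<close>. The argument \<open>1 - 2t\<close>, rather than \<open>2t - 1\<close>, makes the value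
  at \<open>0\<close> equal to \<open>sqrt (2n + 1)\<close>, since \<open>P\<^sub>n(1) = 1\<close>.\<close>

definition legt_basis :: "nat \<Rightarrow> real \<Rightarrow> real" where
  "legt_basis n t = sqrt (2 * real n + 1) * legendre n (1 - 2 * t)"

text \<open>The exponent \<open>k - n\<close> is only used for \<open>k > n\<close>, and \<open>(-1)\<close> has the same powers
  for \<open>n - k\<close> and \<open>k - n\<close>.\<close>

definition legt_A :: "nat \<Rightarrow> real mat" where
  "legt_A N = mat N N (\<lambda>(n, k).
     - sqrt (2 * real n + 1) * sqrt (2 * real k + 1) * (if k \<le> n then 1 else (-1) ^ (k - n)))"

definition legt_B :: "nat \<Rightarrow> real vec" where
  "legt_B N = vec N (\<lambda>n. sqrt (2 * real n + 1))"

definition legt_C :: "nat \<Rightarrow> real vec" where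
  "legt_C N = vec N (\<lambda>n. legt_basis n 1)"

end

theory Submission
  imports Defs "HOL-Real_Asymp.Real_Asymp"
begin

text \<open>
  Let \<open>p\<^sub>n\<close> be the basis functions, \<open>b = (p\<^sub>n(0))\<close>, \<open>c = (p\<^sub>n(1))\<close> and let \<open>d\<close> be the matrix of
  differentiation, \<open>p\<^sub>n' = \<Sum> d\<^sub>n\<^sub>k p\<^sub>k\<close>; integration by parts makes \<open>d + d\<^sup>T = c c\<^sup>T - b b\<^sup>T\<close>. Both systems
  have the form \<open>A = d - \<kappa> c c\<^sup>T\<close>, \<open>B = b + (\<kappa> - 1) c\<close>, \<open>C = \<kappa> c\<^sup>T\<close>, \<open>D = 1 - \<kappa>\<close>, with \<open>\<kappa> = 2\<close> for
  Fourier and \<open>\<kappa> = 1\<close> for Legendre. This is the exact transport of a window of length 1 in the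
  coefficients \<open>W\<^sub>n(s) = \<integral> \<phi>(s + \<theta>) p\<^sub>n(\<theta>) d\<theta>\<close>, except that \<open>\<phi>(s + 1)\<close> is replaced by its
  reconstruction \<open>\<kappa> c W(s) - (\<kappa> - 1) \<phi>(s)\<close>. Differentiating \<open>C exp(sA) W(s)\<close> therefore expresses the
  kernel error through the reconstruction error \<open>\<epsilon>(s)\<close> and the output \<open>C exp(sA) c\<close>, and the
  dissipation of the energy \<open>|C exp(sA)|\<^sup>2\<close> bounds that output in \<open>L\<^sup>2\<close> by \<open>|C|\<close>. It remains to see
  that \<open>\<epsilon>\<close> is \<open>o(1/|C|)\<close>: for Fourier \<open>|C|\<close> is of order \<open>\<surd>N\<close> and \<open>\<epsilon> = O(1/N)\<close>, for Legendre
  \<open>|C| = N\<close> and \<open>\<epsilon> = O(N\<^sup>-\<^sup>3\<^sup>/\<^sup>2)\<close>.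
\<close>

hide_const (open) module.smult

section \<open>The matrix exponential\<close>

lemma index_mult_mat_sum:
  assumes "A \<in> carrier_mat n m" "B \<in> carrier_mat m k" "i < n" "j < k"
  shows "(A * B) $$ (i, j) = (\<Sum>l<m. A $$ (i, l) * B $$ (l, j))"
  using assms by (auto simp: scalar_prod_def atLeast0LessThan intro!: sum.cong)

lemma smult_pow_mat:
  fixes A :: "'a :: comm_semiring_1 mat"
  assumes A: "A \<in> carrier_mat n n"
  shows "(c \<cdot>\<^sub>m A) ^\<^sub>m k = c ^ k \<cdot>\<^sub>m A ^\<^sub>m k"
proof (induction k)
  case 0
  show ?case using A by auto
next
  case (Suc k)
  have "(c \<cdot>\<^sub>m A) ^\<^sub>m Suc k = (c ^ k \<cdot>\<^sub>m A ^\<^sub>m k) * (c \<cdot>\<^sub>m A)"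
    by (simp add: Suc)
  also have "\<dots> = c ^ Suc k \<cdot>\<^sub>m A ^\<^sub>m Suc k"
    using A by (intro eq_matI) (auto simp: mult_ac)
  finally show ?case .
qed

text \<open>Geometric growth of the entries is what makes the entry series of the exponential
  converge absolutely. The constant \<open>a\<close>, the sum of all absolute entries, dominates
  every column sum, so each further factor \<open>A\<close> on the right costs at most a factor
  \<open>a\<close>.\<close>

lemma pow_mat_entry_bound:
  fixes A :: "real mat"
  assumes A: "A \<in> carrier_mat n n"
  obtains a where "\<And>k i j. i < n \<Longrightarrow> j < n \<Longrightarrow> \<bar>(A ^\<^sub>m k) $$ (i, j)\<bar> \<le> a ^ k"
proof -
  define a where "a = (\<Sum>i<n. \<Sum>j<n. \<bar>A $$ (i, j)\<bar>)"
  have col: "(\<Sum>l<n. \<bar>A $$ (l, j)\<bar>) \<le> a" if "j < n" for j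
    unfolding a_def using that by (intro sum_mono member_le_sum) auto
  have "\<bar>(A ^\<^sub>m k) $$ (i, j)\<bar> \<le> a ^ k" if "i < n" "j < n" for k i j
    using that(2)
  proof (induction k arbitrary: j)
    case 0
    then show ?case using A that(1) by auto
  next
    case (Suc k)
    have "0 \<le> a" unfolding a_def by (intro sum_nonneg) auto
    have "\<bar>(A ^\<^sub>m Suc k) $$ (i, j)\<bar> = \<bar>\<Sum>l<n. (A ^\<^sub>m k) $$ (i, l) * A $$ (l, j)\<bar>"
      using index_mult_mat_sum[of "A ^\<^sub>m k" n n A n i j] A that(1) Suc.prems by simp
    also have "\<dots> \<le> (\<Sum>l<n. a ^ k * \<bar>A $$ (l, j)\<bar>)"
      by (intro order_trans[OF sum_abs] sum_mono) (auto simp: abs_mult intro!: mult_right_mono Suc.IH)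
    also have "\<dots> = a ^ k * (\<Sum>l<n. \<bar>A $$ (l, j)\<bar>)"
      by (simp add: sum_distrib_left)
    also have "\<dots> \<le> a ^ k * a"
      using col[OF Suc.prems] \<open>0 \<le> a\<close> by (intro mult_left_mono) auto
    finally show ?case by (simp add: mult.commute)
  qed
  then show thesis by (rule that)
qed

lemma summable_mat_exp_entry:
  fixes A :: "real mat"
  assumes A: "A \<in> carrier_mat n n" and "i < n" "j < n"
  shows "summable (\<lambda>k. (A ^\<^sub>m k) $$ (i, j) / fact k * t ^ k)"
proof -
  obtain a where a: "\<And>k i j. i < n \<Longrightarrow> j < n \<Longrightarrow> \<bar>(A ^\<^sub>m k) $$ (i, j)\<bar> \<le> a ^ k"
    using pow_mat_entry_bound[OF A] by blast
  show ?thesis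
  proof (rule summable_comparison_test')
    show "summable (\<lambda>k. inverse (fact k) * (\<bar>t\<bar> * a) ^ k)"
      by (rule summable_exp)
    show "norm ((A ^\<^sub>m k) $$ (i, j) / fact k * t ^ k) \<le> inverse (fact k) * (\<bar>t\<bar> * a) ^ k"
      if "k \<ge> 0" for k
      using mult_right_mono[OF a[OF assms(2,3), of k], of "\<bar>t\<bar> ^ k / fact k"]
      by (simp add: abs_mult power_abs power_mult_distrib field_simps)
  qed
qed

lemma mat_exp_smult_entry:
  fixes A :: "real mat"
  assumes A: "A \<in> carrier_mat n n" and "i < n" "j < n"
  shows "mat_exp (t \<cdot>\<^sub>m A) $$ (i, j) = (\<Sum>k. (A ^\<^sub>m k) $$ (i, j) / fact k * t ^ k)"
proof -
  have "((t \<cdot>\<^sub>m A) ^\<^sub>m k) $$ (i, j) = (A ^\<^sub>m k) $$ (i, j) * t ^ k" for k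
    using assms by (simp add: smult_pow_mat[OF A] mult_ac)
  then show ?thesis
    using assms by (simp add: mat_exp_def mult_ac)
qed

lemma mat_exp_zero_entry:
  fixes A :: "real mat"
  assumes "A \<in> carrier_mat n n" "i < n" "j < n"
  shows "mat_exp (0 \<cdot>\<^sub>m A) $$ (i, j) = (if i = j then 1 else 0)"
proof -
  have "mat_exp (0 \<cdot>\<^sub>m A) $$ (i, j) = (A ^\<^sub>m 0) $$ (i, j) / fact 0"
    unfolding mat_exp_smult_entry[OF assms] by (rule powser_zero)
  then show ?thesis using assms by simp
qed

text \<open>Termwise differentiation shifts the coefficients to those of
  \<open>A ^\<^sub>m Suc k\<close> over \<open>fact k\<close>. Splitting off the last factor gives
  \<open>exp(tA) A\<close>, with \<open>A\<close> on the right, as suits a row vector multiplied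
  from the left.\<close>

lemma has_derivative_mat_exp_entry:
  fixes A :: "real mat"
  assumes A: "A \<in> carrier_mat n n" and ij: "i < n" "j < n"
  shows "((\<lambda>t. mat_exp (t \<cdot>\<^sub>m A) $$ (i, j)) has_real_derivative
           (\<Sum>l<n. mat_exp (t \<cdot>\<^sub>m A) $$ (i, l) * A $$ (l, j))) (at t)"
proof -
  let ?c = "\<lambda>j k. (A ^\<^sub>m k) $$ (i, j) / fact k"
  have "((\<lambda>t. \<Sum>k. ?c j k * t ^ k) has_real_derivative (\<Sum>k. diffs (?c j) k * t ^ k)) (at t)"
    by (rule termdiffs_strong_converges_everywhere) (rule summable_mat_exp_entry[OF A ij])
  moreover have "diffs (?c j) k * t ^ k = (\<Sum>l<n. ?c l k * t ^ k * A $$ (l, j))" for k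
  proof -
    have "diffs (?c j) k = (A ^\<^sub>m Suc k) $$ (i, j) / fact k"
      by (simp add: diffs_def del: pow_mat.simps)
    also have "\<dots> = (\<Sum>l<n. (A ^\<^sub>m k) $$ (i, l) * A $$ (l, j)) / fact k"
      using index_mult_mat_sum[of "A ^\<^sub>m k" n n A n i j] A ij by simp
    finally show ?thesis by (simp add: sum_divide_distrib sum_distrib_left sum_distrib_right mult_ac)
  qed
  moreover have "(\<Sum>k. \<Sum>l<n. ?c l k * t ^ k * A $$ (l, j)) =
      (\<Sum>l<n. mat_exp (t \<cdot>\<^sub>m A) $$ (i, l) * A $$ (l, j))"
  proof -
    have summ: "summable (\<lambda>k. ?c l k * t ^ k)" if "l < n" for l
      using summable_mat_exp_entry[OF A ij(1) that] .
    have "(\<Sum>k. \<Sum>l<n. ?c l k * t ^ k * A $$ (l, j)) =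
        (\<Sum>l<n. \<Sum>k. ?c l k * t ^ k * A $$ (l, j))"
      by (intro suminf_sum summable_mult2 summ) auto
    also have "\<dots> = (\<Sum>l<n. (\<Sum>k. ?c l k * t ^ k) * A $$ (l, j))"
      by (intro sum.cong refl suminf_mult2[symmetric] summ) auto
    finally show ?thesis using A ij(1) by (simp add: mat_exp_smult_entry)
  qed
  moreover have "mat_exp (t \<cdot>\<^sub>m A) $$ (i, j) = (\<Sum>k. ?c j k * t ^ k)" for t
    by (rule mat_exp_smult_entry[OF A ij])
  ultimately show ?thesis by simp
qed

text \<open>The row \<open>C exp(tA)\<close> is followed, rather than the column
  \<open>exp(tA) B\<close>, because it solves \<open>x' = x A\<close> with initial energy
  \<open>|C|\<close> squared and can be paired with the window coefficients.\<close>

definition exp_row :: "real mat \<Rightarrow> real vec \<Rightarrow> real \<Rightarrow> nat \<Rightarrow> real" where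
  "exp_row A C t j = (\<Sum>i<dim_row A. C $ i * mat_exp (t \<cdot>\<^sub>m A) $$ (i, j))"

lemma exp_row_zero:
  assumes "A \<in> carrier_mat n n" "j < n"
  shows "exp_row A C 0 j = C $ j"
  using assms by (simp add: exp_row_def mat_exp_zero_entry if_distrib[of "\<lambda>x. _ * x"] cong: if_cong)

lemma has_derivative_exp_row:
  assumes A: "A \<in> carrier_mat n n" and j: "j < n"
  shows "((\<lambda>t. exp_row A C t j) has_real_derivative (\<Sum>l<n. exp_row A C t l * A $$ (l, j))) (at t)"
proof -
  have "((\<lambda>t. exp_row A C t j) has_real_derivative
      (\<Sum>i<n. C $ i * (\<Sum>l<n. mat_exp (t \<cdot>\<^sub>m A) $$ (i, l) * A $$ (l, j)))) (at t)"
    unfolding exp_row_def using A j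
    by (auto intro!: DERIV_sum DERIV_cmult has_derivative_mat_exp_entry)
  also have "(\<Sum>i<n. C $ i * (\<Sum>l<n. mat_exp (t \<cdot>\<^sub>m A) $$ (i, l) * A $$ (l, j))) =
      (\<Sum>l<n. exp_row A C t l * A $$ (l, j))"
    using A unfolding exp_row_def sum_distrib_left sum_distrib_right
    by (subst sum.swap) (simp add: mult_ac)
  finally show ?thesis .
qed

lemma kernel_eq_exp_row:
  assumes A: "A \<in> carrier_mat n n" and B: "B \<in> carrier_vec n" and C: "C \<in> carrier_vec n"
  shows "C \<bullet> (mat_exp (t \<cdot>\<^sub>m A) *\<^sub>v B) = (\<Sum>j<n. exp_row A C t j * B $ j)"
proof -
  have "C \<bullet> (mat_exp (t \<cdot>\<^sub>m A) *\<^sub>v B) =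
      (\<Sum>i<n. C $ i * (\<Sum>j<n. mat_exp (t \<cdot>\<^sub>m A) $$ (i, j) * B $ j))"
    using A B C by (auto simp: scalar_prod_def mat_exp_def atLeast0LessThan intro!: sum.cong)
  also have "\<dots> = (\<Sum>j<n. exp_row A C t j * B $ j)"
    using A unfolding exp_row_def sum_distrib_left sum_distrib_right
    by (subst sum.swap) (simp add: mult_ac)
  finally show ?thesis .
qed

section \<open>Kernel error and reconstruction error\<close>

lemma has_real_derivative_imp_continuous_on:
  assumes "\<And>x. (f has_real_derivative f' x) (at x)"
  shows "continuous_on S f"
  using assms DERIV_isCont continuous_at_imp_continuous_on by blast

lemma integral_parts:
  fixes f g f' g' :: "real \<Rightarrow> real"
  assumes f: "\<And>x. (f has_real_derivative f' x) (at x)" and f': "continuous_on UNIV f'"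
    and g: "\<And>x. (g has_real_derivative g' x) (at x)" and g': "continuous_on UNIV g'"
    and "a \<le> b"
  shows "integral {a..b} (\<lambda>x. f x * g' x) = f b * g b - f a * g a - integral {a..b} (\<lambda>x. f' x * g x)"
proof -
  have "((\<lambda>x. f' x * g x + f x * g' x) has_integral f b * g b - f a * g a) {a..b}"
  proof (rule fundamental_theorem_of_calculus)
    show "((\<lambda>x. f x * g x) has_vector_derivative f' x * g x + f x * g' x) (at x within {a..b})" for x
      using DERIV_mult[OF f g, of x]
      by (simp add: has_real_derivative_iff_has_vector_derivative has_vector_derivative_at_within mult.commute add.commute)
  qed (rule \<open>a \<le> b\<close>)
  moreover have "integral {a..b} (\<lambda>x. f' x * g x + f x * g' x) =
      integral {a..b} (\<lambda>x. f' x * g x) + integral {a..b} (\<lambda>x. f x * g' x)"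
    by (intro integral_add integrable_continuous_real continuous_on_mult
        continuous_on_subset[OF f'] continuous_on_subset[OF g']
        has_real_derivative_imp_continuous_on[OF f] has_real_derivative_imp_continuous_on[OF g]) auto
  ultimately show ?thesis by (simp add: integral_unique)
qed

lemma integral_abs_Cauchy_Schwarz:
  fixes y :: "real \<Rightarrow> real"
  assumes y: "continuous_on {a..b} y" and "a \<le> b"
  shows "(integral {a..b} (\<lambda>x. \<bar>y x\<bar>))\<^sup>2 \<le> (b - a) * integral {a..b} (\<lambda>x. (y x)\<^sup>2)"
proof (cases "a = b")
  case False
  define I Q where "I = integral {a..b} (\<lambda>x. \<bar>y x\<bar>)" and "Q = integral {a..b} (\<lambda>x. (y x)\<^sup>2)"
  have I: "((\<lambda>x. \<bar>y x\<bar>) has_integral I) {a..b}" and Q: "((\<lambda>x. (y x)\<^sup>2) has_integral Q) {a..b}"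
    unfolding I_def Q_def by (intro integrable_integral integrable_continuous_real continuous_intros y)+
  \<comment> \<open>The integrand is the expansion of the square of
    \<open>(b - a) * \<bar>y x\<bar> - I\<close>, which measures the deviation of
    \<open>\<bar>y\<bar>\<close> from its mean.\<close>
  have "((\<lambda>x. (b - a)\<^sup>2 * (y x)\<^sup>2 - 2 * (b - a) * I * \<bar>y x\<bar> + I\<^sup>2) has_integral
      (b - a)\<^sup>2 * Q - 2 * (b - a) * I * I + I\<^sup>2 * (b - a)) {a..b}"
    using has_integral_const_real[of "I\<^sup>2" a b] \<open>a \<le> b\<close>
    by (intro has_integral_add has_integral_diff has_integral_mult_right I Q) (simp add: mult.commute)
  then have "0 \<le> (b - a)\<^sup>2 * Q - 2 * (b - a) * I * I + I\<^sup>2 * (b - a)"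
  proof (rule has_integral_nonneg)
    show "0 \<le> (b - a)\<^sup>2 * (y x)\<^sup>2 - 2 * (b - a) * I * \<bar>y x\<bar> + I\<^sup>2" for x
      using zero_le_power2[of "(b - a) * \<bar>y x\<bar> - I"]
      unfolding power2_diff[of "(b - a) * \<bar>y x\<bar>" I] by (simp add: power_mult_distrib mult_ac)
  qed
  also have "\<dots> = (b - a) * ((b - a) * Q - I\<^sup>2)"
    by (simp add: power2_eq_square algebra_simps)
  finally show ?thesis
    using False \<open>a \<le> b\<close> by (simp add: zero_le_mult_iff I_def Q_def)
qed simp

text \<open>Differentiation under the integral falls on \<open>\<phi>\<close>; integration by parts
  in \<open>\<theta>\<close> moves it to \<open>p\<close>. The boundary terms are the sample
  entering the window at \<open>s + 1\<close> and the one leaving at \<open>s\<close>.\<close>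

lemma has_derivative_correlation:
  fixes \<phi> \<phi>' p p' :: "real \<Rightarrow> real"
  assumes \<phi>: "\<And>x. (\<phi> has_real_derivative \<phi>' x) (at x)" and \<phi>': "continuous_on UNIV \<phi>'"
    and p: "\<And>x. (p has_real_derivative p' x) (at x)" and p': "continuous_on UNIV p'"
  shows "((\<lambda>s. integral {0..1} (\<lambda>\<theta>. \<phi> (s + \<theta>) * p \<theta>)) has_real_derivative
           \<phi> (s + 1) * p 1 - \<phi> s * p 0 - integral {0..1} (\<lambda>\<theta>. \<phi> (s + \<theta>) * p' \<theta>)) (at s)"
proof -
  have c\<phi>: "continuous_on UNIV \<phi>"
    using \<phi> by (rule has_real_derivative_imp_continuous_on)
  have cp: "continuous_on UNIV p"
    using p by (rule has_real_derivative_imp_continuous_on)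
  note cont = continuous_on_compose2[OF \<phi>'] continuous_on_compose2[OF c\<phi>]
    continuous_on_compose2[OF cp] continuous_on_compose2[OF p']
  have "((\<lambda>s. integral (cbox 0 1) (\<lambda>\<theta>. \<phi> (s + \<theta>) * p \<theta>)) has_field_derivative
      integral (cbox 0 1) (\<lambda>\<theta>. \<phi>' (s + \<theta>) * p \<theta>)) (at s within UNIV)"
  proof (rule leibniz_rule_field_derivative)
    show "((\<lambda>x. \<phi> (x + t) * p t) has_real_derivative \<phi>' (x + t) * p t) (at x within UNIV)" for x t
      using \<phi>[of "x + t"] by (auto intro!: DERIV_cmult_right simp: DERIV_shift)
    show "(\<lambda>\<theta>. \<phi> (x + \<theta>) * p \<theta>) integrable_on cbox 0 1" for x
      by (intro integrable_continuous continuous_intros cont) auto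
    show "continuous_on (UNIV \<times> cbox 0 1) (\<lambda>(x, t). \<phi>' (x + t) * p t)"
      unfolding split_def by (intro continuous_intros cont) auto
  qed auto
  moreover have "integral {0..1} (\<lambda>\<theta>. \<phi> (s + \<theta>) * p' \<theta>) =
      \<phi> (s + 1) * p 1 - \<phi> (s + 0) * p 0 - integral {0..1} (\<lambda>\<theta>. \<phi>' (s + \<theta>) * p \<theta>)"
  proof (rule integral_parts)
    show "((\<lambda>\<theta>. \<phi> (s + \<theta>)) has_real_derivative \<phi>' (s + x)) (at x)" for x
      using \<phi>[of "x + s", unfolded DERIV_shift] by (simp add: add.commute)
    show "continuous_on UNIV (\<lambda>\<theta>. \<phi>' (s + \<theta>))"
      by (intro continuous_intros cont) auto
  qed (use p p' in auto)
  then have "integral {0..1} (\<lambda>\<theta>. \<phi>' (s + \<theta>) * p \<theta>) =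
      \<phi> (s + 1) * p 1 - \<phi> s * p 0 - integral {0..1} (\<lambda>\<theta>. \<phi> (s + \<theta>) * p' \<theta>)"
    by simp
  ultimately show ?thesis by simp
qed

section \<open>Energy dissipation and the kernel error\<close>

text \<open>A quadratic form sees only the symmetric part of \<open>d\<close>, so twice the form of
  \<open>A\<close> is \<open>(1 - 2 * \<kappa>)\<close> times the square of \<open>x c\<close>,
  minus the square of \<open>x b\<close>. With \<open>\<kappa> \<ge> 1\<close> the feedback
  outweighs the inflow through \<open>c\<close>.\<close>

lemma feedback_dissipation:
  fixes d :: "nat \<Rightarrow> nat \<Rightarrow> real"
  assumes skew: "\<And>n k. n < N \<Longrightarrow> k < N \<Longrightarrow> d n k + d k n = c n * c k - b n * b k"
    and "\<kappa> \<ge> 1"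
  shows "2 * (\<Sum>n<N. x n * (\<Sum>l<N. x l * (d l n - \<kappa> * c l * c n))) \<le> - (\<Sum>n<N. x n * c n)\<^sup>2"
proof -
  let ?S = "\<Sum>n<N. \<Sum>l<N. x n * x l * d l n"
  have sq: "(\<Sum>n<N. x n * f n)\<^sup>2 = (\<Sum>n<N. \<Sum>l<N. x n * x l * (f n * f l))" for f
    unfolding power2_eq_square sum_product by (simp add: mult_ac)
  \<comment> \<open>Exchanging the names of the two summation indices transposes \<open>d\<close> in
    one of the two copies.\<close>
  have "2 * ?S = ?S + (\<Sum>n<N. \<Sum>l<N. x n * x l * d n l)"
    by (subst (3) sum.swap) (simp add: mult_ac)
  also have "\<dots> = (\<Sum>n<N. \<Sum>l<N. x n * x l * (d n l + d l n))"
    by (simp add: sum.distrib[symmetric] algebra_simps)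
  also have "\<dots> = (\<Sum>n<N. \<Sum>l<N. x n * x l * (c n * c l) - x n * x l * (b n * b l))"
    by (intro sum.cong refl) (simp add: skew algebra_simps)
  also have "\<dots> = (\<Sum>n<N. x n * c n)\<^sup>2 - (\<Sum>n<N. x n * b n)\<^sup>2"
    by (simp add: sq sum_subtractf)
  finally have S: "2 * ?S = (\<Sum>n<N. x n * c n)\<^sup>2 - (\<Sum>n<N. x n * b n)\<^sup>2" .
  have "(\<Sum>n<N. x n * (\<Sum>l<N. x l * (d l n - \<kappa> * c l * c n))) =
      (\<Sum>n<N. \<Sum>l<N. x n * x l * d l n - \<kappa> * (x n * x l * (c n * c l)))"
    unfolding sum_distrib_left by (intro sum.cong refl) (simp add: algebra_simps)
  also have "\<dots> = ?S - \<kappa> * (\<Sum>n<N. x n * c n)\<^sup>2"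
    by (simp add: sq sum_subtractf sum_distrib_left)
  finally have "2 * (\<Sum>n<N. x n * (\<Sum>l<N. x l * (d l n - \<kappa> * c l * c n))) =
      2 * ?S - 2 * \<kappa> * (\<Sum>n<N. x n * c n)\<^sup>2"
    by simp
  also have "\<dots> \<le> - (\<Sum>n<N. x n * c n)\<^sup>2"
    using mult_right_mono[OF \<open>\<kappa> \<ge> 1\<close>, of "(\<Sum>n<N. x n * c n)\<^sup>2", OF zero_le_power2] S
      zero_le_power2[of "\<Sum>n<N. x n * b n"] by linarith
  finally show ?thesis .
qed

text \<open>The energy \<open>?E\<close> of the row decreases at least at the rate
  \<open>(?y s)\<^sup>2\<close>, so the total squared output is at most the initial energy.
  Cauchy-Schwarz passes to the integral of \<open>\<bar>?y s\<bar>\<close> at the price of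
  \<open>sqrt T\<close>, which stays fixed as the state size grows.\<close>

lemma integral_abs_output_bound:
  fixes A :: "real mat" and d :: "nat \<Rightarrow> nat \<Rightarrow> real"
  assumes A: "A \<in> carrier_mat N N"
    and A_eq: "\<And>n k. n < N \<Longrightarrow> k < N \<Longrightarrow> A $$ (n, k) = d n k - \<kappa> * c n * c k"
    and skew: "\<And>n k. n < N \<Longrightarrow> k < N \<Longrightarrow> d n k + d k n = c n * c k - b n * b k"
    and "\<kappa> \<ge> 1" and "T \<ge> 0"
  shows "integral {0..T} (\<lambda>s. \<bar>\<Sum>n<N. exp_row A C s n * c n\<bar>) \<le> sqrt (T * (\<Sum>n<N. (C $ n)\<^sup>2))"
proof -
  let ?y = "\<lambda>s. \<Sum>n<N. exp_row A C s n * c n"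
  let ?E = "\<lambda>s. \<Sum>n<N. (exp_row A C s n)\<^sup>2"
  let ?E' = "\<lambda>s. 2 * (\<Sum>n<N. exp_row A C s n * (\<Sum>l<N. exp_row A C s l * (d l n - \<kappa> * c l * c n)))"
  have dx: "((\<lambda>t. exp_row A C t n) has_real_derivative
      (\<Sum>l<N. exp_row A C t l * (d l n - \<kappa> * c l * c n))) (at t)" if "n < N" for t n
    using has_derivative_exp_row[OF A that] A_eq that by simp
  have cx: "continuous_on S (\<lambda>t. exp_row A C t n)" if "n < N" for S n
    using dx[OF that] by (rule has_real_derivative_imp_continuous_on)
  have cy: "continuous_on S ?y" for S
    by (intro continuous_intros cx) auto
  have dE: "(?E has_real_derivative ?E' s) (at s)" for s
  proof -
    have "((\<lambda>t. (exp_row A C t n)\<^sup>2) has_real_derivative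
        2 * (exp_row A C s n * (\<Sum>l<N. exp_row A C s l * (d l n - \<kappa> * c l * c n)))) (at s)"
      if "n < N" for n
      using DERIV_power[OF dx[OF that], of 2] by (simp add: mult_ac)
    then show ?thesis
      unfolding sum_distrib_left[of 2] by (intro DERIV_sum) auto
  qed
  have E': "(?E' has_integral ?E T - ?E 0) {0..T}"
    using \<open>T \<ge> 0\<close> dE
    by (intro fundamental_theorem_of_calculus)
      (auto simp: has_real_derivative_iff_has_vector_derivative has_vector_derivative_at_within)
  have int_sq: "(\<lambda>s. (?y s)\<^sup>2) integrable_on {0..T}"
    by (intro integrable_continuous_real continuous_intros cy)
  have "integral {0..T} (\<lambda>s. (?y s)\<^sup>2) \<le> integral {0..T} (\<lambda>s. - ?E' s)"
  proof (rule integral_le)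
    show "(\<lambda>s. - ?E' s) integrable_on {0..T}"
      by (rule integrable_neg) (rule has_integral_integrable[OF E'])
    show "(?y s)\<^sup>2 \<le> - ?E' s" for s
      using feedback_dissipation[of N d c b \<kappa> "exp_row A C s"] skew \<open>\<kappa> \<ge> 1\<close> by simp
  qed (rule int_sq)
  also have "\<dots> = ?E 0 - ?E T"
    using has_integral_neg[OF E'] by (simp only: integral_unique minus_diff_eq)
  also have "\<dots> \<le> ?E 0"
    by (simp add: sum_nonneg)
  also have "\<dots> = (\<Sum>n<N. (C $ n)\<^sup>2)"
    using A by (simp add: exp_row_zero)
  finally have sq: "integral {0..T} (\<lambda>s. (?y s)\<^sup>2) \<le> (\<Sum>n<N. (C $ n)\<^sup>2)" .
  have "(integral {0..T} (\<lambda>s. \<bar>?y s\<bar>))\<^sup>2 \<le> T * integral {0..T} (\<lambda>s. (?y s)\<^sup>2)"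
    using integral_abs_Cauchy_Schwarz[OF cy \<open>T \<ge> 0\<close>] by simp
  also have "\<dots> \<le> T * (\<Sum>n<N. (C $ n)\<^sup>2)"
    by (rule mult_left_mono[OF sq \<open>T \<ge> 0\<close>])
  finally show ?thesis by (rule real_le_rsqrt)
qed

text \<open>\<open>W\<close> obeys the exact transport equation, and \<open>A\<close>,
  \<open>B\<close> are that equation with \<open>\<phi> (s + 1)\<close> replaced by its
  reconstruction. Hence in the derivative of \<open>G = C exp(sA) W(s)\<close> everything cancels
  except \<open>K s * \<phi> s\<close> and the output times the reconstruction error; integrating
  from \<open>0\<close> to \<open>T\<close> compares the kernel with
  \<open>\<phi> 1\<close>.\<close>

lemma kernel_error:
  fixes A :: "real mat" and p d :: "nat \<Rightarrow> _" and \<phi> \<phi>' :: "real \<Rightarrow> real"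
  assumes A: "A \<in> carrier_mat N N" and B: "B \<in> carrier_vec N" and C: "C \<in> carrier_vec N"
    and A_eq: "\<And>n k. n < N \<Longrightarrow> k < N \<Longrightarrow> A $$ (n, k) = d n k - \<kappa> * p n 1 * p k 1"
    and B_eq: "\<And>n. n < N \<Longrightarrow> B $ n = p n 0 + (\<kappa> - 1) * p n 1"
    and C_eq: "\<And>n. n < N \<Longrightarrow> C $ n = \<kappa> * p n 1"
    and deriv: "\<And>n t. n < N \<Longrightarrow> (p n has_real_derivative (\<Sum>k<N. d n k * p k t)) (at t)"
    and skew: "\<And>n k. n < N \<Longrightarrow> k < N \<Longrightarrow> d n k + d k n = p n 1 * p k 1 - p n 0 * p k 0"
    and "\<kappa> \<ge> 1"
    and \<phi>: "\<And>x. (\<phi> has_real_derivative \<phi>' x) (at x)" and \<phi>': "continuous_on UNIV \<phi>'"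
    and "T \<ge> 0" and supp: "\<And>x. x \<ge> T \<Longrightarrow> \<phi> x = 0"
    and E: "\<And>s. s \<in> {0..T} \<Longrightarrow>
      \<bar>\<kappa> * (\<Sum>n<N. p n 1 * integral {0..1} (\<lambda>\<theta>. \<phi> (s + \<theta>) * p n \<theta>)) - \<phi> (s + 1) - (\<kappa> - 1) * \<phi> s\<bar> \<le> E"
  shows "\<bar>ssm_kernel A B C (1 - \<kappa>) \<phi> - \<phi> 1\<bar> \<le> E * (1 + sqrt (T * (\<Sum>n<N. (C $ n)\<^sup>2)))"
proof -
  let ?\<rho> = "exp_row A C"
  define W where "W n s = integral {0..1} (\<lambda>\<theta>. \<phi> (s + \<theta>) * p n \<theta>)" for n s
  define \<epsilon> where "\<epsilon> s = \<kappa> * (\<Sum>n<N. p n 1 * W n s) - \<phi> (s + 1) - (\<kappa> - 1) * \<phi> s" for s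
  define y where "y s = (\<Sum>n<N. ?\<rho> s n * p n 1)" for s
  define K where "K s = (\<Sum>n<N. ?\<rho> s n * B $ n)" for s
  have c\<phi>: "continuous_on S \<phi>" for S
    using \<phi> by (rule has_real_derivative_imp_continuous_on)
  have cp: "continuous_on S (p n)" if "n < N" for n S
    using deriv[OF that] by (rule has_real_derivative_imp_continuous_on)
  have d\<rho>: "((\<lambda>t. ?\<rho> t n) has_real_derivative (\<Sum>l<N. ?\<rho> t l * (d l n - \<kappa> * p l 1 * p n 1))) (at t)"
    if "n < N" for t n
    using has_derivative_exp_row[OF A that] A_eq that by simp
  have c\<rho>: "continuous_on S (\<lambda>t. ?\<rho> t n)" if "n < N" for S n
    using d\<rho>[OF that] by (rule has_real_derivative_imp_continuous_on)
  have dW: "(W n has_real_derivative \<phi> (s + 1) * p n 1 - \<phi> s * p n 0 - (\<Sum>k<N. d n k * W k s)) (at s)"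
    if "n < N" for n s
  proof -
    have "integral {0..1} (\<lambda>\<theta>. \<phi> (s + \<theta>) * (\<Sum>k<N. d n k * p k \<theta>)) =
        integral {0..1} (\<lambda>\<theta>. \<Sum>k<N. d n k * (\<phi> (s + \<theta>) * p k \<theta>))"
      by (simp add: sum_distrib_left mult_ac)
    also have "\<dots> = (\<Sum>k<N. integral {0..1} (\<lambda>\<theta>. d n k * (\<phi> (s + \<theta>) * p k \<theta>)))"
      by (intro integral_sum integrable_continuous_real continuous_intros cp
          continuous_on_compose2[OF c\<phi>[of UNIV]]) auto
    also have "\<dots> = (\<Sum>k<N. d n k * W k s)"
      unfolding W_def by simp
    finally have "integral {0..1} (\<lambda>\<theta>. \<phi> (s + \<theta>) * (\<Sum>k<N. d n k * p k \<theta>)) =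
        (\<Sum>k<N. d n k * W k s)" .
    moreover have "continuous_on UNIV (\<lambda>t. \<Sum>k<N. d n k * p k t)"
      by (intro continuous_intros cp) auto
    ultimately show ?thesis
      using has_derivative_correlation[OF \<phi> \<phi>' deriv[OF that], of s]
      unfolding W_def by simp
  qed
  have cW: "continuous_on S (W n)" if "n < N" for S n
    using dW[OF that] by (rule has_real_derivative_imp_continuous_on)
  have c\<epsilon>: "continuous_on S \<epsilon>" and cy: "continuous_on S y" and cK: "continuous_on S K" for S
    unfolding \<epsilon>_def y_def K_def
    by (intro continuous_intros cW c\<rho> c\<phi> continuous_on_compose2[OF c\<phi>[of UNIV]]; simp)+
  define G where "G s = (\<Sum>n<N. ?\<rho> s n * W n s)" for s
  have dG: "(G has_real_derivative - (K s * \<phi> s + y s * \<epsilon> s)) (at s)" for s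
  proof -
    let ?c = "\<Sum>n<N. p n 1 * W n s"
    have "(G has_real_derivative
        (\<Sum>n<N. (\<Sum>l<N. ?\<rho> s l * (d l n - \<kappa> * p l 1 * p n 1)) * W n s
          + ?\<rho> s n * (\<phi> (s + 1) * p n 1 - \<phi> s * p n 0 - (\<Sum>k<N. d n k * W k s)))) (at s)"
      unfolding G_def by (auto intro!: DERIV_sum derivative_eq_intros d\<rho> dW simp: mult_ac)
    also have "(\<Sum>n<N. (\<Sum>l<N. ?\<rho> s l * (d l n - \<kappa> * p l 1 * p n 1)) * W n s
          + ?\<rho> s n * (\<phi> (s + 1) * p n 1 - \<phi> s * p n 0 - (\<Sum>k<N. d n k * W k s))) =
        (\<Sum>n<N. \<Sum>l<N. ?\<rho> s l * d l n * W n s) - \<kappa> * y s * ?c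
          + (\<Sum>n<N. ?\<rho> s n * (\<phi> (s + 1) * p n 1 - \<phi> s * p n 0))
          - (\<Sum>n<N. \<Sum>k<N. ?\<rho> s n * d n k * W k s)"
    proof -
      have "\<kappa> * y s * ?c = (\<Sum>n<N. \<Sum>l<N. \<kappa> * ?\<rho> s l * p l 1 * p n 1 * W n s)"
        unfolding y_def by (subst sum.swap) (simp add: sum_product sum_distrib_left mult_ac)
      then show ?thesis
        by (simp add: sum.distrib sum_subtractf sum_distrib_left sum_distrib_right algebra_simps)
    qed
    \<comment> \<open>The \<open>d\<close> terms coming from \<open>?\<rho>\<close> and from
      \<open>W\<close> are the same double sum and cancel.\<close>
    also have "(\<Sum>n<N. \<Sum>l<N. ?\<rho> s l * d l n * W n s) = (\<Sum>n<N. \<Sum>k<N. ?\<rho> s n * d n k * W k s)"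
      by (rule sum.swap)
    \<comment> \<open>Writing \<open>p n 0\<close> as \<open>B $ n - (\<kappa> - 1) * p n 1\<close>
      brings in the kernel \<open>K\<close>; the remaining multiple of \<open>\<phi> s\<close> joins
      the output \<open>y\<close>.\<close>
    also have "(\<Sum>n<N. ?\<rho> s n * (\<phi> (s + 1) * p n 1 - \<phi> s * p n 0)) =
        (\<phi> (s + 1) + (\<kappa> - 1) * \<phi> s) * y s - \<phi> s * K s"
      unfolding y_def K_def
      by (simp add: B_eq sum_distrib_left sum_subtractf[symmetric] algebra_simps)
    finally show ?thesis unfolding \<epsilon>_def by (simp add: algebra_simps)
  qed
  have "((\<lambda>s. - (K s * \<phi> s + y s * \<epsilon> s)) has_integral G T - G 0) {0..T}"
    using \<open>T \<ge> 0\<close> dG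
    by (intro fundamental_theorem_of_calculus)
      (auto simp: has_real_derivative_iff_has_vector_derivative has_vector_derivative_at_within)
  from has_integral_neg[OF this]
  have "integral {0..T} (\<lambda>s. K s * \<phi> s + y s * \<epsilon> s) = G 0 - G T"
    by (simp only: integral_unique minus_diff_eq minus_minus)
  moreover have "integral {0..T} (\<lambda>s. K s * \<phi> s + y s * \<epsilon> s) =
      integral {0..T} (\<lambda>s. K s * \<phi> s) + integral {0..T} (\<lambda>s. y s * \<epsilon> s)"
    by (intro integral_add integrable_continuous_real continuous_intros c\<phi> cy cK c\<epsilon>)
  \<comment> \<open>The window starting at \<open>T\<close> lies beyond the support of
    \<open>\<phi>\<close>.\<close>
  moreover have "G T = 0"
  proof -
    have "W n T = integral {0..1} (\<lambda>\<theta> :: real. 0)" for n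
      unfolding W_def by (intro Henstock_Kurzweil_Integration.integral_cong) (simp add: supp)
    then show ?thesis by (simp add: G_def)
  qed
  \<comment> \<open>At \<open>s = 0\<close> the exponential is the identity, so \<open>G 0\<close>
    is the reconstruction itself. Its surplus \<open>(\<kappa> - 1) * \<phi> 0\<close> is cancelled
    by the feedthrough \<open>1 - \<kappa>\<close>.\<close>
  moreover have "G 0 = \<phi> 1 + (\<kappa> - 1) * \<phi> 0 + \<epsilon> 0"
    unfolding G_def \<epsilon>_def using A by (simp add: exp_row_zero C_eq sum_distrib_left mult_ac)
  moreover have "(LBINT t:{0..}. (scalar_prod C (mat_exp (t \<cdot>\<^sub>m A) *\<^sub>v B)) * \<phi> t) =
      integral {0..T} (\<lambda>s. K s * \<phi> s)"
  proof -
    have "(LBINT t:{0..}. (scalar_prod C (mat_exp (t \<cdot>\<^sub>m A) *\<^sub>v B)) * \<phi> t) = (LBINT t:{0..T}. K t * \<phi> t)"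
      unfolding set_lebesgue_integral_def K_def
      by (intro Bochner_Integration.integral_cong)
        (auto simp: kernel_eq_exp_row[OF A B C] indicator_def supp)
    also have "\<dots> = integral {0..T} (\<lambda>s. K s * \<phi> s)"
      by (intro set_borel_integral_eq_integral borel_integrable_atLeastAtMost' continuous_intros cK c\<phi>)
    finally show ?thesis .
  qed
  ultimately have err: "ssm_kernel A B C (1 - \<kappa>) \<phi> - \<phi> 1 = \<epsilon> 0 - integral {0..T} (\<lambda>s. y s * \<epsilon> s)"
    unfolding ssm_kernel_def dirac_def by (simp add: algebra_simps)
  have E': "\<bar>\<epsilon> s\<bar> \<le> E" if "s \<in> {0..T}" for s
    using E[OF that] unfolding \<epsilon>_def W_def .
  have "E \<ge> 0" using E'[of 0] \<open>T \<ge> 0\<close> by auto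
  have "norm (integral {0..T} (\<lambda>s. y s * \<epsilon> s)) \<le> integral {0..T} (\<lambda>s. E * \<bar>y s\<bar>)"
  proof (rule integral_norm_bound_integral)
    show "norm (y s * \<epsilon> s) \<le> E * \<bar>y s\<bar>" if "s \<in> {0..T}" for s
      using E'[OF that] mult_left_mono[of "\<bar>\<epsilon> s\<bar>" E "\<bar>y s\<bar>"] by (simp add: abs_mult mult.commute)
  qed (auto intro!: integrable_continuous_real continuous_intros cy c\<epsilon>)
  also have "\<dots> = E * integral {0..T} (\<lambda>s. \<bar>y s\<bar>)" by simp
  also have "\<dots> \<le> E * (sqrt (T * (\<Sum>n<N. (C $ n)\<^sup>2)))"
    using integral_abs_output_bound[where d = d and c = "\<lambda>n. p n 1" and b = "\<lambda>n. p n 0", OF A A_eq skew \<open>\<kappa> \<ge> 1\<close> \<open>T \<ge> 0\<close>, of C]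
    unfolding y_def by (intro mult_left_mono \<open>E \<ge> 0\<close>) auto
  finally show ?thesis
    using E'[of 0] \<open>T \<ge> 0\<close> unfolding err by (auto simp: algebra_simps)
qed

section \<open>Data extracted from a test function\<close>

text \<open>The bound \<open>M\<close> is taken on \<open>{0..T + 1}\<close> because this interval
  contains every window from \<open>s\<close> to \<open>s + 1\<close> with \<open>s\<close> in
  \<open>{0..T}\<close>.\<close>

lemma test_function_derivs:
  assumes "test_function \<phi>"
  obtains \<phi>' \<phi>'' T M where "\<And>x. (\<phi> has_real_derivative \<phi>' x) (at x)"
    "\<And>x. (\<phi>' has_real_derivative \<phi>'' x) (at x)" "continuous_on UNIV \<phi>''"
    "T > 0" "\<And>x. x \<ge> T \<Longrightarrow> \<phi> x = 0" "\<And>x. x \<in> {0..T + 1} \<Longrightarrow> \<bar>\<phi>'' x\<bar> \<le> M"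
proof -
  have diff: "(deriv ^^ k) \<phi> field_differentiable (at x)" for k x
    using assms by (simp add: test_function_def)
  have d: "((deriv ^^ k) \<phi> has_real_derivative (deriv ^^ Suc k) \<phi> x) (at x)" for k x
    using diff[of k x] by (simp add: DERIV_deriv_iff_field_differentiable)
  have c: "continuous_on UNIV ((deriv ^^ 2) \<phi>)"
    by (rule has_real_derivative_imp_continuous_on[OF d])
  have "bounded (closure {x. \<phi> x \<noteq> 0})"
    using assms compact_imp_bounded by (auto simp: test_function_def)
  then obtain a where a: "\<And>x. x \<in> closure {x. \<phi> x \<noteq> 0} \<Longrightarrow> norm x \<le> a"
    unfolding bounded_iff by blast
  \<comment> \<open>The added \<open>1\<close> makes \<open>T\<close> positive and puts the point
    \<open>T\<close> itself strictly outside the support.\<close>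
  define T where "T = \<bar>a\<bar> + 1"
  have supp: "\<phi> x = 0" if "x \<ge> T" for x
    using a[of x] closure_subset[of "{x. \<phi> x \<noteq> 0}"] that unfolding T_def by fastforce
  have "bounded ((deriv ^^ 2) \<phi> ` {0..T + 1})"
    by (intro compact_imp_bounded compact_continuous_image continuous_on_subset[OF c]) auto
  then obtain M where M: "\<And>x. x \<in> {0..T + 1} \<Longrightarrow> \<bar>(deriv ^^ 2) \<phi> x\<bar> \<le> M"
    unfolding bounded_iff by (auto simp del: atLeastAtMost_iff)
  show thesis
    using that[of "(deriv ^^ 1) \<phi>" "(deriv ^^ 2) \<phi>" T M] d[of 0] d[of 1] c supp M
    by (simp add: T_def numeral_2_eq_2)
qed

lemma has_real_derivative_shift:
  assumes "\<And>x. (f has_real_derivative f' x) (at x)"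
  shows "((\<lambda>x. f (s + x)) has_real_derivative f' (s + x)) (at x)"
  using assms[of "x + s", unfolded DERIV_shift] by (simp add: add.commute)

lemma integral_mult_bound:
  fixes f g :: "real \<Rightarrow> real"
  assumes f: "continuous_on {0..1} f" and g: "continuous_on {0..1} g"
    and M: "\<And>x. x \<in> {0..1} \<Longrightarrow> \<bar>f x\<bar> \<le> M"
  shows "\<bar>integral {0..1} (\<lambda>x. f x * g x)\<bar> \<le> M * sqrt (integral {0..1} (\<lambda>x. (g x)\<^sup>2))"
proof -
  have "M \<ge> 0" using M[of 0] by auto
  have "norm (integral {0..1} (\<lambda>x. f x * g x)) \<le> integral {0..1} (\<lambda>x. M * \<bar>g x\<bar>)"
  proof (rule integral_norm_bound_integral)
    show "norm (f x * g x) \<le> M * \<bar>g x\<bar>" if "x \<in> {0..1}" for x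
      using M[OF that] by (simp add: abs_mult mult_right_mono)
  qed (auto intro!: integrable_continuous_real continuous_intros f g)
  also have "\<dots> = M * integral {0..1} (\<lambda>x. \<bar>g x\<bar>)" by simp
  also have "\<dots> \<le> M * sqrt (integral {0..1} (\<lambda>x. (g x)\<^sup>2))"
    using integral_abs_Cauchy_Schwarz[OF g] by (intro mult_left_mono real_le_rsqrt \<open>M \<ge> 0\<close>) auto
  finally show ?thesis by simp
qed

section \<open>The Fourier system\<close>

lemma cos_2pi_of_nat: "cos (2 * pi * real j) = 1"
  using cos_int_2pin[of "int j"] by simp

lemma sin_2pi_of_nat: "sin (2 * pi * real j) = 0"
  using sin_int_2pin[of "int j"] by simp

definition fourier_dirichlet :: "nat \<Rightarrow> real \<Rightarrow> real" where
  "fourier_dirichlet m \<theta> = 1 + (\<Sum>j=1..m. 2 * cos (2 * pi * real j * \<theta>))"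

text \<open>The next two functions are iterated antiderivatives of the Dirichlet kernel, with constants
  chosen so that they tend to 0: they are minus the tails of the Fourier series of
  \<open>1/2 - \<theta>\<close> and of \<open>\<theta>(1 - \<theta>)/2\<close>.\<close>

definition fourier_sawtooth :: "nat \<Rightarrow> real \<Rightarrow> real" where
  "fourier_sawtooth m \<theta> = \<theta> - 1 / 2 + (\<Sum>j=1..m. sin (2 * pi * real j * \<theta>) / (pi * real j))"

definition fourier_parabola :: "nat \<Rightarrow> real \<Rightarrow> real" where
  "fourier_parabola m \<theta> =
     \<theta> * (\<theta> - 1) / 2 + (\<Sum>j=1..m. (1 - cos (2 * pi * real j * \<theta>)) / (2 * pi\<^sup>2 * (real j)\<^sup>2))"

lemma has_derivative_sawtooth:
  "(fourier_sawtooth m has_real_derivative fourier_dirichlet m \<theta>) (at \<theta>)"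
  unfolding fourier_sawtooth_def fourier_dirichlet_def
  by (auto intro!: derivative_eq_intros sum.cong)

lemma has_derivative_parabola:
  "(fourier_parabola m has_real_derivative fourier_sawtooth m \<theta>) (at \<theta>)"
  unfolding fourier_parabola_def fourier_sawtooth_def
  by (auto intro!: derivative_eq_intros sum.cong simp: power2_eq_square)

lemma sawtooth_0: "fourier_sawtooth m 0 = - 1 / 2"
  by (simp add: fourier_sawtooth_def)

lemma sawtooth_1: "fourier_sawtooth m 1 = 1 / 2"
  by (simp add: fourier_sawtooth_def sin_2pi_of_nat)

lemma parabola_0: "fourier_parabola m 0 = 0"
  by (simp add: fourier_parabola_def)

lemma parabola_1: "fourier_parabola m 1 = 0"
  by (simp add: fourier_parabola_def cos_2pi_of_nat)

lemma has_integral_cos_2pi: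
  fixes k :: int
  assumes "k \<noteq> 0"
  shows "((\<lambda>\<theta>. cos (2 * pi * real_of_int k * \<theta>)) has_integral 0) {0..1}"
proof -
  have "((\<lambda>\<theta>. cos (2 * pi * real_of_int k * \<theta>)) has_integral
      sin (2 * pi * real_of_int k * 1) / (2 * pi * real_of_int k) -
      sin (2 * pi * real_of_int k * 0) / (2 * pi * real_of_int k)) {0..1}"
  proof (rule fundamental_theorem_of_calculus)
    have "((\<lambda>\<theta>. sin (2 * pi * real_of_int k * \<theta>) / (2 * pi * real_of_int k)) has_real_derivative
        cos (2 * pi * real_of_int k * x)) (at x within {0..1})" for x
      using assms by (auto intro!: derivative_eq_intros)
    then show "((\<lambda>\<theta>. sin (2 * pi * real_of_int k * \<theta>) / (2 * pi * real_of_int k)) has_vector_derivative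
        cos (2 * pi * real_of_int k * x)) (at x within {0..1})" for x
      by (simp add: has_real_derivative_iff_has_vector_derivative)
  qed simp
  then show ?thesis using sin_int_2pin[of k] by simp
qed

text \<open>By the product-to-sum formula only the frequencies \<open>J\<close> and
  \<open>J - j\<close>, \<open>J + j\<close> with \<open>j \<le> m\<close> occur;
  \<open>J > m\<close> keeps them all nonzero.\<close>

lemma integral_dirichlet_cos:
  assumes "J > m"
  shows "integral {0..1} (\<lambda>\<theta>. fourier_dirichlet m \<theta> * cos (2 * pi * real J * \<theta>)) = 0"
proof -
  have eq: "fourier_dirichlet m \<theta> * cos (2 * pi * real J * \<theta>) = cos (2 * pi * real_of_int (int J) * \<theta>) +
      (\<Sum>j=1..m. cos (2 * pi * real_of_int (int J - int j) * \<theta>) + cos (2 * pi * real_of_int (int J + int j) * \<theta>))"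
    for \<theta>
  proof -
    have "2 * cos (2 * pi * real j * \<theta>) * cos (2 * pi * real J * \<theta>) =
        cos (2 * pi * real_of_int (int J - int j) * \<theta>) + cos (2 * pi * real_of_int (int J + int j) * \<theta>)" for j
      using cos_times_cos[of "2 * pi * real J * \<theta>" "2 * pi * real j * \<theta>"]
      by (simp add: algebra_simps)
    then show ?thesis
      unfolding fourier_dirichlet_def by (simp add: distrib_right sum_distrib_right)
  qed
  have "((\<lambda>\<theta>. fourier_dirichlet m \<theta> * cos (2 * pi * real J * \<theta>)) has_integral 0 + (\<Sum>j=1..m. 0 + 0)) {0..1}"
    unfolding eq using assms by (intro has_integral_add has_integral_sum has_integral_cos_2pi) auto
  then show ?thesis by (simp add: integral_unique)
qed

lemma integral_sin_squared:
  assumes "J > 0"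
  shows "integral {0..1} (\<lambda>\<theta>. (sin (2 * pi * real J * \<theta>))\<^sup>2) = 1 / 2"
proof -
  have "(sin (2 * pi * real J * \<theta>))\<^sup>2 = (1 - cos (2 * pi * real_of_int (2 * int J) * \<theta>)) / 2" for \<theta>
    using cos_double_sin[of "2 * pi * real J * \<theta>"] by (simp add: algebra_simps)
  moreover have "((\<lambda>\<theta>. (1 - cos (2 * pi * real_of_int (2 * int J) * \<theta>)) / 2) has_integral (1 - 0) / 2) {0..1}"
    using assms has_integral_const_real[of "1 :: real" 0 1]
    by (intro has_integral_divide has_integral_diff has_integral_cos_2pi) auto
  ultimately show ?thesis by (simp only: integral_unique diff_zero)
qed

lemma continuous_sawtooth: "continuous_on S (fourier_sawtooth m)"
  by (rule has_real_derivative_imp_continuous_on[OF has_derivative_sawtooth])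

lemma continuous_dirichlet: "continuous_on S (fourier_dirichlet m)"
  unfolding fourier_dirichlet_def by (intro continuous_intros)

text \<open>This is Parseval for the tail of the sawtooth series, obtained by adding one sine at a
  time: \<open>1 / 12\<close> is the squared norm of \<open>\<theta> - 1 / 2\<close>, and each new
  frequency removes its own share.\<close>

lemma integral_sawtooth_squared:
  "integral {0..1} (\<lambda>\<theta>. (fourier_sawtooth m \<theta>)\<^sup>2) = 1 / 12 - (\<Sum>j=1..m. 1 / (real j)\<^sup>2) / (2 * pi\<^sup>2)"
proof (induction m)
  case 0
  have "((\<lambda>\<theta>. (\<theta> - 1 / 2)\<^sup>2) has_integral (1 - 1 / 2) ^ 3 / 3 - (0 - 1 / 2) ^ 3 / 3) {0..1 :: real}"
  proof (rule fundamental_theorem_of_calculus)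
    have "((\<lambda>\<theta>. (\<theta> - 1 / 2) ^ 3 / 3) has_real_derivative (x - 1 / 2)\<^sup>2) (at x within {0..1})" for x :: real
      by (auto intro!: derivative_eq_intros)
    then show "((\<lambda>\<theta>. (\<theta> - 1 / 2) ^ 3 / 3) has_vector_derivative (x - 1 / 2)\<^sup>2) (at x within {0..1})" for x :: real
      by (simp add: has_real_derivative_iff_has_vector_derivative)
  qed simp
  from integral_unique[OF this] show ?case
    by (simp add: fourier_sawtooth_def power3_eq_cube)
next
  case (Suc m)
  let ?J = "real (Suc m)"
  let ?s = "\<lambda>\<theta>. sin (2 * pi * ?J * \<theta>)"
  \<comment> \<open>After integration by parts the Dirichlet kernel of order \<open>m\<close> meets
    a cosine of frequency \<open>m + 1\<close> and integrates to 0, so only the boundary values of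
    the sawtooth contribute.\<close>
  have cross: "integral {0..1} (\<lambda>\<theta>. fourier_sawtooth m \<theta> * ?s \<theta>) = - 1 / (2 * pi * ?J)"
  proof -
    have "integral {0..1} (\<lambda>\<theta>. fourier_sawtooth m \<theta> * ?s \<theta>) =
        fourier_sawtooth m 1 * (- cos (2 * pi * ?J * 1) / (2 * pi * ?J)) -
        fourier_sawtooth m 0 * (- cos (2 * pi * ?J * 0) / (2 * pi * ?J)) -
        integral {0..1} (\<lambda>\<theta>. fourier_dirichlet m \<theta> * (- cos (2 * pi * ?J * \<theta>) / (2 * pi * ?J)))"
      by (intro integral_parts has_derivative_sawtooth continuous_dirichlet)
        (auto intro!: derivative_eq_intros continuous_intros)
    also have "(\<lambda>\<theta>. fourier_dirichlet m \<theta> * (- cos (2 * pi * ?J * \<theta>) / (2 * pi * ?J))) =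
        (\<lambda>\<theta>. - (1 / (2 * pi * ?J)) * (fourier_dirichlet m \<theta> * cos (2 * pi * ?J * \<theta>)))"
      by auto
    also have "integral {0..1} \<dots> = 0"
      using integral_dirichlet_cos[of m "Suc m"] by (simp only: integral_mult_right)
    finally show ?thesis
      using cos_2pi_of_nat[of "Suc m"] by (simp add: sawtooth_0 sawtooth_1)
  qed
  have "(fourier_sawtooth (Suc m) \<theta>)\<^sup>2 =
      (fourier_sawtooth m \<theta>)\<^sup>2 + 2 / (pi * ?J) * (fourier_sawtooth m \<theta> * ?s \<theta>) + 1 / (pi * ?J)\<^sup>2 * (?s \<theta>)\<^sup>2" for \<theta>
  proof -
    have "fourier_sawtooth (Suc m) \<theta> = fourier_sawtooth m \<theta> + ?s \<theta> / (pi * ?J)"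
      by (simp add: fourier_sawtooth_def)
    then show ?thesis
      by (simp only: power2_sum power_divide) simp
  qed
  then have "integral {0..1} (\<lambda>\<theta>. (fourier_sawtooth (Suc m) \<theta>)\<^sup>2) =
      integral {0..1} (\<lambda>\<theta>. (fourier_sawtooth m \<theta>)\<^sup>2 + 2 / (pi * ?J) * (fourier_sawtooth m \<theta> * ?s \<theta>) + 1 / (pi * ?J)\<^sup>2 * (?s \<theta>)\<^sup>2)"
    by (simp only:)
  also have "\<dots> = integral {0..1} (\<lambda>\<theta>. (fourier_sawtooth m \<theta>)\<^sup>2) +
      integral {0..1} (\<lambda>\<theta>. 2 / (pi * ?J) * (fourier_sawtooth m \<theta> * ?s \<theta>)) +
      integral {0..1} (\<lambda>\<theta>. 1 / (pi * ?J)\<^sup>2 * (?s \<theta>)\<^sup>2)"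
  proof -
    have "(\<lambda>\<theta>. (fourier_sawtooth m \<theta>)\<^sup>2) integrable_on {0..1}"
      "(\<lambda>\<theta>. 2 / (pi * ?J) * (fourier_sawtooth m \<theta> * ?s \<theta>)) integrable_on {0..1}"
      "(\<lambda>\<theta>. 1 / (pi * ?J)\<^sup>2 * (?s \<theta>)\<^sup>2) integrable_on {0..1}"
      by (intro integrable_continuous_real continuous_intros continuous_sawtooth)+
    then show ?thesis by (simp only: Henstock_Kurzweil_Integration.integral_add integrable_add)
  qed
  also have "\<dots> = integral {0..1} (\<lambda>\<theta>. (fourier_sawtooth m \<theta>)\<^sup>2) + 2 / (pi * ?J) * (- 1 / (2 * pi * ?J)) + 1 / (pi * ?J)\<^sup>2 * (1 / 2)"
    using integral_sin_squared[of "Suc m"] by (simp only: integral_mult_right cross)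
  also have "\<dots> = integral {0..1} (\<lambda>\<theta>. (fourier_sawtooth m \<theta>)\<^sup>2) - 1 / ?J\<^sup>2 / (2 * pi\<^sup>2)"
    by (simp add: field_simps power2_eq_square)
  finally show ?case using Suc by (simp add: add_divide_distrib)
qed

text \<open>The parabola is the integral of the sawtooth from 0, so the L2 norm of the sawtooth
  bounds it. That norm tends to 0 by the Basel sum, which cancels \<open>1 / 12\<close>
  exactly.\<close>

lemma parabola_tendsto_0:
  assumes "\<theta> \<in> {0..1}"
  shows "(\<lambda>m. fourier_parabola m \<theta>) \<longlonglongrightarrow> 0"
proof -
  have "(\<lambda>m. \<Sum>j<m. 1 / (real j + 1)\<^sup>2) \<longlonglongrightarrow> pi\<^sup>2 / 6"
    using inverse_squares_sums by (simp add: sums_def add.commute)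
  moreover have "(\<Sum>j<m. 1 / (real j + 1)\<^sup>2) = (\<Sum>j=1..m. 1 / (real j)\<^sup>2)" for m
    by (rule sum.reindex_bij_witness[of _ "\<lambda>j. j - 1" Suc]) auto
  ultimately have "(\<lambda>m. 1 / 12 - (\<Sum>j=1..m. 1 / (real j)\<^sup>2) / (2 * pi\<^sup>2)) \<longlonglongrightarrow> 1 / 12 - pi\<^sup>2 / 6 / (2 * pi\<^sup>2)"
    by (intro tendsto_intros) auto
  then have lim: "(\<lambda>m. sqrt (integral {0..1} (\<lambda>\<theta>. (fourier_sawtooth m \<theta>)\<^sup>2))) \<longlonglongrightarrow> 0"
    unfolding integral_sawtooth_squared[symmetric] by (auto intro!: tendsto_eq_intros)
  show ?thesis
  proof (rule Lim_null_comparison[OF _ lim], rule always_eventually, rule allI)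
    fix m
    have "(fourier_sawtooth m has_integral fourier_parabola m \<theta> - fourier_parabola m 0) {0..\<theta>}"
      using assms has_derivative_parabola
      by (intro fundamental_theorem_of_calculus)
        (auto simp: has_real_derivative_iff_has_vector_derivative has_vector_derivative_at_within)
    then have "fourier_parabola m \<theta> = integral {0..\<theta>} (fourier_sawtooth m)"
      by (simp add: parabola_0 integral_unique)
    also have "norm \<dots> \<le> integral {0..\<theta>} (\<lambda>x. \<bar>fourier_sawtooth m x\<bar>)"
      by (intro integral_norm_bound_integral integrable_continuous_real continuous_intros continuous_sawtooth) auto
    also have "\<dots> \<le> integral {0..1} (\<lambda>x. \<bar>fourier_sawtooth m x\<bar>)"
      using assms by (intro integral_subset_le integrable_continuous_real continuous_intros continuous_sawtooth) auto
    also have "\<dots> \<le> sqrt (integral {0..1} (\<lambda>x. (fourier_sawtooth m x)\<^sup>2))"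
      using integral_abs_Cauchy_Schwarz[OF continuous_sawtooth, of 0 1 m] by (intro real_le_rsqrt) auto
    finally show "norm (fourier_parabola m \<theta>) \<le> sqrt (integral {0..1} (\<lambda>x. (fourier_sawtooth m x)\<^sup>2))" .
  qed
qed

lemma inverse_square_le_telescope:
  fixes x :: real
  assumes "x > 0"
  shows "1 / (x + 1)\<^sup>2 \<le> 1 / x - 1 / (x + 1)"
proof -
  have "1 / (x + 1)\<^sup>2 \<le> 1 / (x * (x + 1))"
    using assms by (intro frac_le) (auto simp: power2_eq_square)
  also have "\<dots> = 1 / x - 1 / (x + 1)"
    using assms by (simp add: field_simps)
  finally show ?thesis .
qed

text \<open>Knowing the limit 0, a rate follows from the increments: the term of frequency
  \<open>j\<close> is at most \<open>1 / j^2\<close>, which a telescoping difference dominates, so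
  all later values stay within \<open>1 / m\<close> of the current one.\<close>

lemma parabola_bound:
  assumes "\<theta> \<in> {0..1}" "m > 0"
  shows "\<bar>fourier_parabola m \<theta>\<bar> \<le> 1 / real m"
proof -
  have tail: "\<bar>fourier_parabola (m + i) \<theta> - fourier_parabola m \<theta>\<bar> \<le> 1 / real m - 1 / real (m + i)" for i
  proof (induction i)
    case (Suc i)
    let ?J = "real (Suc (m + i))"
    let ?D = "(1 - cos (2 * pi * ?J * \<theta>)) / (2 * pi\<^sup>2 * ?J\<^sup>2)"
    have "fourier_parabola (m + Suc i) \<theta> = fourier_parabola (m + i) \<theta> + ?D"
      by (simp add: fourier_parabola_def)
    moreover have "\<bar>?D\<bar> \<le> 1 / real (m + i) - 1 / ?J"
    proof -
      have "1 \<le> pi\<^sup>2" using pi_gt3 by (simp add: one_le_power)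
      have "\<bar>?D\<bar> \<le> 2 / (2 * pi\<^sup>2 * ?J\<^sup>2)"
        unfolding abs_divide by (intro frac_le) (auto intro: order_trans[OF abs_triangle_ineq4])
      also have "\<dots> \<le> 1 / ?J\<^sup>2"
        using \<open>1 \<le> pi\<^sup>2\<close> by (simp add: divide_simps)
      also have "\<dots> \<le> 1 / real (m + i) - 1 / ?J"
        using inverse_square_le_telescope[of "real (m + i)"] \<open>m > 0\<close> by (simp add: add_ac)
      finally show ?thesis .
    qed
    ultimately show ?case using Suc by (simp only: add_Suc_right)
  qed simp
  have "(\<lambda>i. \<bar>fourier_parabola (i + m) \<theta> - fourier_parabola m \<theta>\<bar>) \<longlonglongrightarrow> \<bar>0 - fourier_parabola m \<theta>\<bar>"
    by (intro tendsto_intros LIMSEQ_ignore_initial_segment parabola_tendsto_0 assms)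
  moreover have "\<bar>fourier_parabola (i + m) \<theta> - fourier_parabola m \<theta>\<bar> \<le> 1 / real m" for i
    using tail[of i] by (smt (verit) add.commute divide_nonneg_nonneg of_nat_0_le_iff)
  ultimately have "\<bar>0 - fourier_parabola m \<theta>\<bar> \<le> 1 / real m"
    by (intro Lim_bounded[where M = 0]) auto
  then show ?thesis by simp
qed

text \<open>A Fourier sum reconstructs at the jump of the periodic extension the mean of the two end
  values; this is why \<open>\<kappa> = 2\<close>. The sawtooth ends \<open>1 / 2\<close> and
  \<open>- 1 / 2\<close> produce that mean, and a second integration by parts has no boundary terms
  and leaves the parabola against \<open>f''\<close>.\<close>

lemma dirichlet_error:
  fixes f f' f'' :: "real \<Rightarrow> real"
  assumes f: "\<And>x. (f has_real_derivative f' x) (at x)" and f': "\<And>x. (f' has_real_derivative f'' x) (at x)"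
    and f'': "continuous_on UNIV f''" and M: "\<And>x. x \<in> {0..1} \<Longrightarrow> \<bar>f'' x\<bar> \<le> M" and "m > 0"
  shows "\<bar>2 * integral {0..1} (\<lambda>\<theta>. f \<theta> * fourier_dirichlet m \<theta>) - f 1 - f 0\<bar> \<le> 2 * M / real m"
proof -
  have "integral {0..1} (\<lambda>\<theta>. f \<theta> * fourier_dirichlet m \<theta>) =
      f 1 * fourier_sawtooth m 1 - f 0 * fourier_sawtooth m 0 - integral {0..1} (\<lambda>\<theta>. f' \<theta> * fourier_sawtooth m \<theta>)"
    by (intro integral_parts f has_derivative_sawtooth continuous_dirichlet
        has_real_derivative_imp_continuous_on[OF f']) auto
  moreover have "integral {0..1} (\<lambda>\<theta>. f' \<theta> * fourier_sawtooth m \<theta>) =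
      f' 1 * fourier_parabola m 1 - f' 0 * fourier_parabola m 0 - integral {0..1} (\<lambda>\<theta>. f'' \<theta> * fourier_parabola m \<theta>)"
    by (intro integral_parts f' has_derivative_parabola continuous_sawtooth f'') auto
  ultimately have "2 * integral {0..1} (\<lambda>\<theta>. f \<theta> * fourier_dirichlet m \<theta>) - f 1 - f 0 =
      2 * integral {0..1} (\<lambda>\<theta>. f'' \<theta> * fourier_parabola m \<theta>)"
    by (simp add: sawtooth_0 sawtooth_1 parabola_0 parabola_1)
  moreover have "norm (integral {0..1} (\<lambda>\<theta>. f'' \<theta> * fourier_parabola m \<theta>)) \<le>
      (M * (1 / real m)) * (1 - 0)"
  proof (rule integral_bound)
    show "continuous_on {0..1} (\<lambda>\<theta>. f'' \<theta> * fourier_parabola m \<theta>)"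
      by (intro continuous_intros continuous_on_subset[OF f'']
          has_real_derivative_imp_continuous_on[OF has_derivative_parabola]) auto
    show "norm (f'' t * fourier_parabola m t) \<le> M * (1 / real m)" if "t \<in> {0..1}" for t
      using mult_mono[OF M[OF that] parabola_bound[OF that \<open>m > 0\<close>]] M[OF that]
      by (auto simp: abs_mult)
  qed simp
  ultimately show ?thesis by (simp add: abs_mult)
qed

section \<open>The Fourier system as transport with feedback\<close>

text \<open>The differentiation matrix \<open>d\<close> of the trigonometric basis: what is left of
  \<open>fout_A\<close> once the rank-one feedback with \<open>\<kappa> = 2\<close> is split
  off.\<close>

definition fout_D :: "nat \<Rightarrow> nat \<Rightarrow> real" where
  "fout_D n k =
     (if n = k + 1 \<and> odd k then 2 * pi * ((real k + 1) / 2)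
      else if k = n + 1 \<and> odd n then -2 * pi * ((real n + 1) / 2)
      else 0)"

lemma fout_basis_at_0: "fout_basis n 0 = (if n = 0 then 1 else if odd n then sqrt 2 else 0)"
  by (simp add: fout_basis_def)

text \<open>Periodicity of the basis. Hence \<open>b = c\<close> for this system, and integration by
  parts makes \<open>fout_D\<close> skew-symmetric.\<close>

lemma fout_basis_at_1: "fout_basis n 1 = fout_basis n 0"
proof (cases "even n")
  case True
  then obtain j where "n = 2 * j" by blast
  then show ?thesis using sin_2pi_of_nat[of j] by (simp add: fout_basis_def)
next
  case False
  then obtain j where "n = 2 * j + 1" using oddE by blast
  then have "(real n + 1) / 2 = real (Suc j)" by simp
  then show ?thesis
    using False cos_2pi_of_nat[of "Suc j"] by (simp only: fout_basis_def) (simp del: of_nat_Suc)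
qed

lemma has_derivative_fout_basis:
  assumes "n < 2 * m + 1"
  shows "(fout_basis n has_real_derivative (\<Sum>k<2 * m + 1. fout_D n k * fout_basis k t)) (at t)"
proof -
  consider "n = 0" | "odd n" | "even n" "n > 0" by blast
  then show ?thesis
  proof cases
    case 1
    then show ?thesis by (simp add: fout_D_def fout_basis_def[abs_def])
  next
    case 2
    \<comment> \<open>The odd size enters here: an odd index below \<open>2 * m + 1\<close> is at
      most \<open>2 * m - 1\<close>, so the sine paired with this cosine is still in the
      basis.\<close>
    have "n + 1 < 2 * m + 1" using assms 2 by presburger
    have "(\<Sum>k<2 * m + 1. fout_D n k * fout_basis k t) = (\<Sum>k<2 * m + 1. if k = n + 1 then fout_D n k * fout_basis k t else 0)"
      using 2 by (intro sum.cong) (auto simp: fout_D_def)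
    also have "\<dots> = fout_D n (n + 1) * fout_basis (n + 1) t"
      using \<open>n + 1 < 2 * m + 1\<close> by (simp add: sum.delta)
    finally have sum: "(\<Sum>k<2 * m + 1. fout_D n k * fout_basis k t) = fout_D n (n + 1) * fout_basis (n + 1) t" .
    have "fout_basis n = (\<lambda>t. sqrt 2 * cos (2 * pi * ((real n + 1) / 2) * t))"
      using 2 by (auto simp: fout_basis_def)
    moreover have "fout_D n (n + 1) * fout_basis (n + 1) t =
        sqrt 2 * (- sin (2 * pi * ((real n + 1) / 2) * t) * (2 * pi * ((real n + 1) / 2)))"
      using 2 by (simp add: fout_D_def fout_basis_def add.commute)
    ultimately show ?thesis
      unfolding sum by (auto intro!: derivative_eq_intros)
  next
    case 3
    then have n: "n = (n - 1) + 1" "odd (n - 1)" by auto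
    have "(\<Sum>k<2 * m + 1. fout_D n k * fout_basis k t) = (\<Sum>k<2 * m + 1. if k = n - 1 then fout_D n k * fout_basis k t else 0)"
      using 3 by (intro sum.cong) (auto simp: fout_D_def)
    also have "\<dots> = fout_D n (n - 1) * fout_basis (n - 1) t"
    proof -
      have "n - 1 \<in> {..<2 * m + 1}" using assms by auto
      then show ?thesis by (simp only: sum.delta finite_lessThan if_True)
    qed
    finally have sum: "(\<Sum>k<2 * m + 1. fout_D n k * fout_basis k t) = fout_D n (n - 1) * fout_basis (n - 1) t" .
    have "fout_basis n = (\<lambda>t. sqrt 2 * sin (2 * pi * (real n / 2) * t))"
      using 3 by (auto simp: fout_basis_def)
    moreover have "fout_D n (n - 1) * fout_basis (n - 1) t =
        sqrt 2 * (cos (2 * pi * (real n / 2) * t) * (2 * pi * (real n / 2)))"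
      using 3 n by (auto simp: fout_D_def fout_basis_def of_nat_diff)
    ultimately show ?thesis
      unfolding sum by (auto intro!: derivative_eq_intros)
  qed
qed

lemma sum_fout_basis:
  "(\<Sum>n<2 * m + 1. fout_basis n 1 * fout_basis n \<theta>) = fourier_dirichlet m \<theta>"
proof (induction m)
  case 0
  show ?case by (simp add: fout_basis_def fourier_dirichlet_def)
next
  case (Suc m)
  have "(\<Sum>n<2 * Suc m + 1. fout_basis n 1 * fout_basis n \<theta>) =
      (\<Sum>n<2 * m + 1. fout_basis n 1 * fout_basis n \<theta>) +
      fout_basis (2 * m + 1) 1 * fout_basis (2 * m + 1) \<theta> + fout_basis (2 * m + 2) 1 * fout_basis (2 * m + 2) \<theta>"
    by simp
  also have "fout_basis (2 * m + 2) 1 = 0"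
    by (simp add: fout_basis_at_1 fout_basis_at_0)
  also have "fout_basis (2 * m + 1) 1 = sqrt 2"
    by (simp add: fout_basis_at_1 fout_basis_at_0)
  also have "fout_basis (2 * m + 1) \<theta> = sqrt 2 * cos (2 * pi * real (Suc m) * \<theta>)"
  proof -
    have "(real (2 * m + 1) + 1) / 2 = real (Suc m)" by simp
    then show ?thesis by (simp only: fout_basis_def) simp
  qed
  finally show ?case
    using Suc by (simp add: fourier_dirichlet_def mult.assoc[symmetric] del: of_nat_Suc)
qed

text \<open>By periodicity the sum is four times the Dirichlet kernel at 0, so \<open>|C|\<close>
  grows like the square root of the state size.\<close>

lemma sum_fout_C: "(\<Sum>n<2 * m + 1. (fout_C (2 * m + 1) $ n)\<^sup>2) = 4 * (2 * real m + 1)"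
proof -
  have "(\<Sum>n<2 * m + 1. (fout_C (2 * m + 1) $ n)\<^sup>2) = 4 * (\<Sum>n<2 * m + 1. fout_basis n 1 * fout_basis n 0)"
    by (simp add: fout_C_def fout_basis_at_1 power2_eq_square sum_distrib_left mult_ac)
  then show ?thesis
    by (simp only: sum_fout_basis) (simp add: fourier_dirichlet_def)
qed

theorem fout_kernel_tendsto:
  "distr_tendsto
     (\<lambda>m. ssm_kernel (fout_A (2 * m + 1)) (fout_B (2 * m + 1)) (fout_C (2 * m + 1)) (-1)) (dirac 1)"
  unfolding distr_tendsto_def
proof (intro allI impI)
  fix \<phi> assume "test_function \<phi>"
  then obtain \<phi>' \<phi>'' T M where \<phi>: "\<And>x. (\<phi> has_real_derivative \<phi>' x) (at x)"
    "\<And>x. (\<phi>' has_real_derivative \<phi>'' x) (at x)" "continuous_on UNIV \<phi>''"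
    "T > 0" "\<And>x. x \<ge> T \<Longrightarrow> \<phi> x = 0" "\<And>x. x \<in> {0..T + 1} \<Longrightarrow> \<bar>\<phi>'' x\<bar> \<le> M"
    by (rule test_function_derivs) blast
  \<comment> \<open>The feedthrough is written \<open>1 - 2\<close> to match
    \<open>kernel_error\<close> at \<open>\<kappa> = 2\<close>.\<close>
  have err: "\<bar>ssm_kernel (fout_A (2 * m + 1)) (fout_B (2 * m + 1)) (fout_C (2 * m + 1)) (1 - 2) \<phi> - \<phi> 1\<bar> \<le>
      2 * M / real m * (1 + sqrt (T * (\<Sum>n<2 * m + 1. (fout_C (2 * m + 1) $ n)\<^sup>2)))" if "m > 0" for m
  proof (rule kernel_error[where d = fout_D and p = fout_basis and \<phi>' = \<phi>'])
    fix s assume s: "s \<in> {0..T}"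
    have c: "continuous_on S \<phi>" "continuous_on S (fout_basis n)" if "n < 2 * m + 1" for n S
      using has_real_derivative_imp_continuous_on[OF \<phi>(1)]
        has_real_derivative_imp_continuous_on[OF has_derivative_fout_basis[OF that]] by blast+
    have "integral {0..1} (\<lambda>\<theta>. \<phi> (s + \<theta>) * fourier_dirichlet m \<theta>) =
        integral {0..1} (\<lambda>\<theta>. \<Sum>n<2 * m + 1. fout_basis n 1 * (\<phi> (s + \<theta>) * fout_basis n \<theta>))"
      by (simp only: sum_fout_basis[symmetric] sum_distrib_left mult_ac)
    also have "\<dots> = (\<Sum>n<2 * m + 1. integral {0..1} (\<lambda>\<theta>. fout_basis n 1 * (\<phi> (s + \<theta>) * fout_basis n \<theta>)))"
      by (intro integral_sum integrable_continuous_real continuous_intros c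
          continuous_on_compose2[OF c(1)[of 0 UNIV]]) auto
    finally have "(\<Sum>n<2 * m + 1. fout_basis n 1 * integral {0..1} (\<lambda>\<theta>. \<phi> (s + \<theta>) * fout_basis n \<theta>)) =
        integral {0..1} (\<lambda>\<theta>. \<phi> (s + \<theta>) * fourier_dirichlet m \<theta>)"
      by simp
    moreover have "\<bar>2 * integral {0..1} (\<lambda>\<theta>. \<phi> (s + \<theta>) * fourier_dirichlet m \<theta>) - \<phi> (s + 1) - \<phi> (s + 0)\<bar> \<le> 2 * M / real m"
      using s that \<phi>(6)
      by (intro dirichlet_error[where f' = "\<lambda>x. \<phi>' (s + x)" and f'' = "\<lambda>x. \<phi>'' (s + x)"]
          has_real_derivative_shift \<phi> continuous_on_compose2[OF \<phi>(3)] continuous_intros) auto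
    ultimately show "\<bar>2 * (\<Sum>n<2 * m + 1. fout_basis n 1 * integral {0..1} (\<lambda>\<theta>. \<phi> (s + \<theta>) * fout_basis n \<theta>)) -
        \<phi> (s + 1) - (2 - 1) * \<phi> s\<bar> \<le> 2 * M / real m"
      by simp
  next
    fix n k assume "n < 2 * m + 1" "k < 2 * m + 1"
    then show "fout_A (2 * m + 1) $$ (n, k) = fout_D n k - 2 * fout_basis n 1 * fout_basis k 1"
      by (auto simp: fout_A_def fout_D_def fout_basis_at_1 fout_basis_at_0)
    show "fout_D n k + fout_D k n = fout_basis n 1 * fout_basis k 1 - fout_basis n 0 * fout_basis k 0"
      by (auto simp: fout_D_def fout_basis_at_1)
  qed (use \<phi> has_derivative_fout_basis in
      \<open>auto simp: fout_A_def fout_B_def fout_C_def fout_basis_at_1 fout_basis_at_0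
        intro: has_real_derivative_imp_continuous_on\<close>)
  \<comment> \<open>A reconstruction error of order \<open>1 / m\<close> beats the growth of
    \<open>|C|\<close>, which is of order \<open>sqrt m\<close>.\<close>
  have lim: "(\<lambda>m. 2 * M / real m * (1 + sqrt (T * (4 * (2 * real m + 1))))) \<longlonglongrightarrow> 0"
  proof -
    have "(\<lambda>m. 1 / real m * (1 + sqrt (T * (4 * (2 * real m + 1))))) \<longlonglongrightarrow> 0"
      using \<open>T > 0\<close> by real_asymp
    from tendsto_mult_right_zero[OF this, of "2 * M"] show ?thesis by simp
  qed
  have "(\<lambda>m. ssm_kernel (fout_A (2 * m + 1)) (fout_B (2 * m + 1)) (fout_C (2 * m + 1)) (-1) \<phi> - \<phi> 1) \<longlonglongrightarrow> 0"
  proof (rule Lim_null_comparison[OF _ lim])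
    show "\<forall>\<^sub>F m in sequentially.
        norm (ssm_kernel (fout_A (2 * m + 1)) (fout_B (2 * m + 1)) (fout_C (2 * m + 1)) (-1) \<phi> - \<phi> 1)
        \<le> 2 * M / real m * (1 + sqrt (T * (4 * (2 * real m + 1))))"
      using eventually_gt_at_top[of 0]
    proof eventually_elim
      case (elim m)
      then show ?case using err[of m] unfolding sum_fout_C by simp
    qed
  qed
  then show "(\<lambda>m. ssm_kernel (fout_A (2 * m + 1)) (fout_B (2 * m + 1)) (fout_C (2 * m + 1)) (-1) \<phi>)
      \<longlonglongrightarrow> dirac 1 \<phi>"
    unfolding dirac_def by (rule LIM_zero_cancel)
qed

section \<open>The Legendre system\<close>

definition legendre_poly :: "nat \<Rightarrow> real poly" where
  "legendre_poly n = smult (1 / (2 ^ n * fact n)) ((pderiv ^^ n) ([:-1, 0, 1:] ^ n))"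

lemma poly_legendre_poly: "poly (legendre_poly n) x = legendre n x"
  by (simp add: legendre_poly_def legendre_def)

text \<open>Only the term in which all \<open>n\<close> derivatives fall on the power survives at
  \<open>a\<close>. The induction generalises \<open>q\<close>, since one derivative replaces it by
  \<open>(n + 1) q + (x - a) q'\<close>.\<close>

lemma poly_higher_pderiv_power:
  fixes a :: real
  shows "poly ((pderiv ^^ n) ([:- a, 1:] ^ n * q)) a = fact n * poly q a"
proof (induction n arbitrary: q)
  case (Suc n)
  have "pderiv ([:- a, 1:] ^ Suc n * q) =
      [:- a, 1:] ^ n * (smult (of_nat (Suc n)) q + [:- a, 1:] * pderiv q)"
    by (simp add: pderiv_mult pderiv_power_Suc pderiv_pCons algebra_simps smult_add_left del: power_Suc)
      (simp add: algebra_simps)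
  then have "(pderiv ^^ Suc n) ([:- a, 1:] ^ Suc n * q) =
      (pderiv ^^ n) ([:- a, 1:] ^ n * (smult (of_nat (Suc n)) q + [:- a, 1:] * pderiv q))"
    by (simp only: funpow_Suc_right comp_apply)
  then show ?case
    by (simp only: Suc.IH) (simp add: algebra_simps)
qed simp

lemma legendre_at_1: "legendre n 1 = 1"
proof -
  have "[:-1, 0, 1:] ^ n = [:-1, 1:] ^ n * ([:1, 1:] ^ n :: real poly)"
    unfolding power_mult_distrib[symmetric] by simp
  then have "poly ((pderiv ^^ n) ([:-1, 0, 1:] ^ n)) 1 = fact n * (2 :: real) ^ n"
    using poly_higher_pderiv_power[of n 1 "[:1, 1:] ^ n"] by simp
  then show ?thesis
    by (simp add: legendre_def)
qed

lemma legendre_at_minus_1: "legendre n (-1) = (-1) ^ n"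
proof -
  have "[:-1, 0, 1:] ^ n = [:1, 1:] ^ n * ([:-1, 1:] ^ n :: real poly)"
    unfolding power_mult_distrib[symmetric] by simp
  then have "poly ((pderiv ^^ n) ([:-1, 0, 1:] ^ n)) (-1) = fact n * (-2 :: real) ^ n"
    using poly_higher_pderiv_power[of n "-1" "[:-1, 1:] ^ n"] by simp
  then show ?thesis
    by (simp add: legendre_def power_minus[of 2])
qed

lemma legendre_poly_0: "legendre_poly 0 = 1"
  by (simp add: legendre_poly_def)

lemma legendre_poly_1: "legendre_poly 1 = [:0, 1:]"
  by (simp add: legendre_poly_def pderiv_pCons)

text \<open>From Rodrigues' formula: the second derivative of \<open>Q (n + 2)\<close> is a
  combination of \<open>Q (n + 1)\<close> and \<open>Q n\<close>, and \<open>n + 1\<close> further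
  derivatives turn these into \<open>legendre_poly (n + 1)\<close> and the derivative of
  \<open>legendre_poly n\<close>.\<close>

lemma pderiv_legendre_poly:
  "pderiv (legendre_poly (n + 2)) = smult (2 * real n + 3) (legendre_poly (n + 1)) + pderiv (legendre_poly n)"
proof -
  have F: "2 ^ (n + 2) * fact (n + 2) = (2 * (real n + 2)) * (2 ^ (n + 1) * fact (n + 1))"
    "2 ^ (n + 1) * fact (n + 1) = (2 * (real n + 1)) * (2 ^ n * fact n)"
    by (simp_all add: algebra_simps)
  have cancel: "1 / (a * b) * (a * c) = c * (1 / b)" if "a \<noteq> 0" for a b c :: real
    using that by simp
  define Q :: "nat \<Rightarrow> real poly" where "Q k = [:-1, 0, 1:] ^ k" for k
  have dQ: "pderiv (Q (Suc k)) = smult (2 * real (Suc k)) ([:0, 1:] * Q k)" for k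
    by (simp add: Q_def pderiv_power_Suc pderiv_pCons del: power_Suc)
  have Q_Suc: "Q (Suc k) = [:-1, 0, 1:] * Q k" for k
    by (simp add: Q_def)
  have "pderiv (pderiv (Q (n + 2))) =
      smult (2 * (real n + 2)) (Q (Suc n) + [:0, 1:] * pderiv (Q (Suc n)))"
    by (simp add: dQ pderiv_smult pderiv_mult pderiv_pCons numeral_2_eq_2 algebra_simps smult_add_right)
  \<comment> \<open>Here \<open>x^2 = (x^2 - 1) + 1\<close> expresses \<open>x^2 Q n\<close> as
    \<open>Q (n + 1) + Q n\<close>.\<close>
  also have "[:0, 1:] * pderiv (Q (Suc n)) =
      smult (2 * (real n + 1)) (Q (Suc n)) + smult (2 * (real n + 1)) (Q n)"
    unfolding dQ by (simp add: Q_Suc smult_diff_right algebra_simps)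
  finally have "pderiv (pderiv (Q (n + 2))) =
      smult (2 * (real n + 2) * (2 * real n + 3)) (Q (n + 1)) +
      smult (2 * (real n + 2) * (2 * (real n + 1))) (Q n)"
    by (simp add: poly_eq_iff algebra_simps)
  moreover have "(pderiv ^^ (n + 3)) (Q (n + 2)) = (pderiv ^^ (n + 1)) (pderiv (pderiv (Q (n + 2))))"
    by (simp add: numeral_3_eq_3 funpow_swap1)
  ultimately have "(pderiv ^^ (n + 3)) (Q (n + 2)) =
      smult (2 * (real n + 2) * (2 * real n + 3)) ((pderiv ^^ (n + 1)) (Q (n + 1))) +
      smult (2 * (real n + 2) * (2 * (real n + 1))) ((pderiv ^^ (n + 1)) (Q n))"
    by (simp only: higher_pderiv_add higher_pderiv_smult)
  moreover have "pderiv (legendre_poly (n + 2)) =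
      smult (1 / (2 ^ (n + 2) * fact (n + 2))) ((pderiv ^^ (n + 3)) (Q (n + 2)))"
    by (simp add: legendre_poly_def Q_def pderiv_smult numeral_3_eq_3 numeral_2_eq_2)
  moreover have "pderiv (legendre_poly n) = smult (1 / (2 ^ n * fact n)) ((pderiv ^^ (n + 1)) (Q n))"
    by (simp add: legendre_poly_def Q_def pderiv_smult)
  moreover have "1 / (2 ^ (n + 2) * fact (n + 2)) * (2 * (real n + 2) * (2 * real n + 3)) =
      (2 * real n + 3) * (1 / (2 ^ (n + 1) * fact (n + 1)))"
    unfolding F(1) by (rule cancel) simp
  moreover have "1 / (2 ^ (n + 2) * fact (n + 2)) * (2 * (real n + 2) * (2 * (real n + 1))) =
      1 / (2 ^ n * fact n :: real)"
    unfolding F by (subst cancel) simp_all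
  ultimately show ?thesis
    by (simp only: smult_add_right smult_smult legendre_poly_def Q_def)
qed

text \<open>The Legendre basis without its normalising factor, which keeps square roots out of the
  polynomial identities.\<close>

definition shifted_legendre :: "nat \<Rightarrow> real poly" where
  "shifted_legendre n = pcompose (legendre_poly n) [:1, -2:]"

lemma legt_basis_eq: "legt_basis n t = sqrt (2 * real n + 1) * poly (shifted_legendre n) t"
  by (simp add: legt_basis_def shifted_legendre_def poly_pcompose poly_legendre_poly mult.commute)

lemma shifted_legendre_at_0: "poly (shifted_legendre n) 0 = 1"
  by (simp add: shifted_legendre_def poly_pcompose poly_legendre_poly legendre_at_1)

lemma shifted_legendre_at_1: "poly (shifted_legendre n) 1 = (-1) ^ n"
  by (simp add: shifted_legendre_def poly_pcompose poly_legendre_poly legendre_at_minus_1)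

lemma shifted_legendre_0: "shifted_legendre 0 = 1"
  by (simp add: shifted_legendre_def legendre_poly_0 pcompose_1)

lemma shifted_legendre_1: "shifted_legendre 1 = [:1, -2:]"
  unfolding shifted_legendre_def legendre_poly_1 by (simp add: pcompose_pCons)

lemma pderiv_shifted_legendre:
  "pderiv (shifted_legendre (n + 2)) =
     pderiv (shifted_legendre n) - smult (2 * (2 * real n + 3)) (shifted_legendre (n + 1))"
  unfolding shifted_legendre_def pderiv_pcompose pderiv_legendre_poly pcompose_add pcompose_smult
  by (simp add: pderiv_pCons algebra_simps)

text \<open>The recurrence read backwards: it supplies an explicit antiderivative of each shifted
  polynomial for integration by parts.\<close>

lemma shifted_legendre_eq_pderiv:
  assumes "n \<ge> 1"
  shows "smult (2 * (2 * real n + 1)) (shifted_legendre n) =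
           pderiv (shifted_legendre (n - 1)) - pderiv (shifted_legendre (n + 1))"
  using pderiv_shifted_legendre[of "n - 1"] assms by (cases n) (simp_all add: algebra_simps)

lemma degree_higher_pderiv_le:
  fixes q :: "real poly"
  shows "degree ((pderiv ^^ k) q) \<le> degree q - k"
proof (induction k)
  case (Suc k)
  then show ?case by (simp add: degree_pderiv)
qed simp

lemma degree_shifted_legendre_le: "degree (shifted_legendre n) \<le> n"
proof -
  have "degree ((pderiv ^^ n) ([:-1, 0, 1:] ^ n :: real poly)) \<le> degree ([:-1, 0, 1:] ^ n :: real poly) - n"
    by (rule degree_higher_pderiv_le)
  also have "\<dots> \<le> n"
    using degree_power_le[of "[:-1, 0, 1:] :: real poly" n] by simp
  finally have "degree (legendre_poly n) \<le> n"
    unfolding legendre_poly_def using degree_smult_le order_trans by blast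
  then show ?thesis
    by (simp add: shifted_legendre_def degree_pcompose)
qed

text \<open>Unrolling the recurrence in steps of two. The sign factor is \<open>-2\<close> when
  \<open>n + k\<close> is odd and 0 otherwise.\<close>

lemma pderiv_shifted_legendre_sum:
  "pderiv (shifted_legendre n) =
     (\<Sum>k<n. smult ((2 * real k + 1) * ((-1) ^ (n + k) - 1)) (shifted_legendre k))"
proof (induction n rule: nat_induct2)
  case 0 show ?case by (simp add: shifted_legendre_0)
next
  case 1 show ?case using shifted_legendre_1 by (simp add: shifted_legendre_0 pderiv_pCons)
next
  case (step n)
  \<comment> \<open>Passing to \<open>n + 2\<close> adds the indices \<open>n\<close> and
    \<open>n + 1\<close> to the sum; the first must get coefficient 0.\<close>
  have "even (n + n)" by simp
  then have "(-1) ^ (n + n) = (1 :: real)" by (simp only: neg_one_even_power)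
  then show ?case unfolding pderiv_shifted_legendre step
    by (simp add: numeral_2_eq_2 poly_eq_iff algebra_simps)
qed

section \<open>Integrals against shifted Legendre polynomials\<close>

lemma continuous_on_poly_real: "continuous_on S (poly (p :: real poly))"
  by (rule has_real_derivative_imp_continuous_on[OF poly_DERIV])

text \<open>The antiderivative \<open>q\<close> vanishes at both ends because \<open>n - 1\<close>
  and \<open>n + 1\<close> have equal parity. Integration by parts thus has no boundary terms and
  gains a factor of order \<open>1 / n\<close>.\<close>

lemma integral_mult_shifted_legendre:
  fixes g g' :: "real \<Rightarrow> real"
  assumes g: "\<And>x. (g has_real_derivative g' x) (at x)" and g': "continuous_on UNIV g'" and "n \<ge> 1"
  shows "2 * (2 * real n + 1) * integral {0..1} (\<lambda>x. g x * poly (shifted_legendre n) x) =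
           integral {0..1} (\<lambda>x. g' x * poly (shifted_legendre (n + 1)) x) -
           integral {0..1} (\<lambda>x. g' x * poly (shifted_legendre (n - 1)) x)"
proof -
  define q where "q = shifted_legendre (n - 1) - shifted_legendre (n + 1)"
  have dq: "pderiv q = smult (2 * (2 * real n + 1)) (shifted_legendre n)"
    using shifted_legendre_eq_pderiv[OF \<open>n \<ge> 1\<close>] by (simp add: q_def pderiv_diff)
  have "poly q 0 = 0" "poly q 1 = 0"
    using \<open>n \<ge> 1\<close> by (cases n; simp add: q_def shifted_legendre_at_0 shifted_legendre_at_1)+
  moreover have "integral {0..1} (\<lambda>x. g x * poly (pderiv q) x) =
      g 1 * poly q 1 - g 0 * poly q 0 - integral {0..1} (\<lambda>x. g' x * poly q x)"
    by (intro integral_parts g g' poly_DERIV continuous_on_poly_real) auto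
  moreover have "integral {0..1} (\<lambda>x. g x * poly (pderiv q) x) =
      2 * (2 * real n + 1) * integral {0..1} (\<lambda>x. g x * poly (shifted_legendre n) x)"
  proof -
    have "(\<lambda>x. g x * poly (pderiv q) x) = (\<lambda>x. 2 * (2 * real n + 1) * (g x * poly (shifted_legendre n) x))"
      by (simp add: dq mult_ac)
    then show ?thesis by (simp only: integral_mult_right)
  qed
  moreover have "integral {0..1} (\<lambda>x. g' x * poly q x) =
      integral {0..1} (\<lambda>x. g' x * poly (shifted_legendre (n - 1)) x) -
      integral {0..1} (\<lambda>x. g' x * poly (shifted_legendre (n + 1)) x)"
    unfolding q_def poly_diff right_diff_distrib
    by (intro Henstock_Kurzweil_Integration.integral_diff integrable_continuous_real continuous_intros
        continuous_on_poly_real continuous_on_subset[OF g']) auto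
  ultimately show ?thesis by simp
qed

text \<open>Each integration by parts lowers the degree of \<open>q\<close> by one and the index by
  at most one, so the degree stays below the index until the derivative is 0.\<close>

lemma shifted_legendre_orthogonal:
  assumes "degree q < n"
  shows "integral {0..1} (\<lambda>x. poly q x * poly (shifted_legendre n) x) = 0"
  using assms
proof (induction "degree q" arbitrary: q n rule: less_induct)
  case less
  have part: "2 * (2 * real n + 1) * integral {0..1} (\<lambda>x. poly q x * poly (shifted_legendre n) x) =
      integral {0..1} (\<lambda>x. poly (pderiv q) x * poly (shifted_legendre (n + 1)) x) -
      integral {0..1} (\<lambda>x. poly (pderiv q) x * poly (shifted_legendre (n - 1)) x)"
    using less.prems by (intro integral_mult_shifted_legendre poly_DERIV continuous_on_poly_real) auto
  have "integral {0..1} (\<lambda>x. poly (pderiv q) x * poly (shifted_legendre k) x) = 0" if "k \<ge> n - 1" for k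
  proof (cases "degree q = 0")
    case True
    then have "pderiv q = 0" by (simp add: pderiv_eq_0_iff)
    then show ?thesis by simp
  next
    case False
    then show ?thesis using less.prems that by (intro less.hyps) (auto simp: degree_pderiv)
  qed
  from this[of "n + 1"] this[of "n - 1"] part
  have "2 * (2 * real n + 1) * integral {0..1} (\<lambda>x. poly q x * poly (shifted_legendre n) x) = 0"
    by simp
  moreover have "2 * (2 * real n + 1) > 0" by simp
  ultimately show ?case by (metis less_irrefl mult_eq_0_iff)
qed

text \<open>Integrating by parts against itself leaves the neighbours \<open>n + 1\<close> and
  \<open>n - 1\<close>. The first is killed by orthogonality; a second integration by parts reduces
  the other to a boundary value.\<close>

lemma integral_shifted_legendre_squared:
  "integral {0..1} (\<lambda>x. (poly (shifted_legendre n) x)\<^sup>2) = 1 / (2 * real n + 1)"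
proof (cases "n = 0")
  case True
  then show ?thesis by (simp add: shifted_legendre_0)
next
  case False
  let ?L = "\<lambda>n. poly (shifted_legendre n)" and ?L' = "\<lambda>n. poly (pderiv (shifted_legendre n))"
  have deg: "degree (pderiv (shifted_legendre k)) < l" if "k \<le> l" "l > 0" for k l
    using degree_shifted_legendre_le[of k] that by (simp add: degree_pderiv)
  have lower: "integral {0..1} (\<lambda>x. ?L' k x * ?L l x) = 0" if "k \<le> l" "l > 0" for k l
    by (intro shifted_legendre_orthogonal deg that)
  have "2 * (2 * real n + 1) * integral {0..1} (\<lambda>x. ?L n x * ?L n x) =
      integral {0..1} (\<lambda>x. ?L' n x * ?L (n + 1) x) - integral {0..1} (\<lambda>x. ?L' n x * ?L (n - 1) x)"
    using False by (intro integral_mult_shifted_legendre poly_DERIV continuous_on_poly_real) auto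
  moreover have "integral {0..1} (\<lambda>x. ?L (n - 1) x * ?L' n x) =
      ?L (n - 1) 1 * ?L n 1 - ?L (n - 1) 0 * ?L n 0 - integral {0..1} (\<lambda>x. ?L' (n - 1) x * ?L n x)"
    by (intro integral_parts poly_DERIV continuous_on_poly_real) auto
  moreover have "?L (n - 1) 1 * ?L n 1 - ?L (n - 1) 0 * ?L n 0 = - 2"
    using False by (cases n) (simp_all add: shifted_legendre_at_0 shifted_legendre_at_1 power_add[symmetric] mult_2[symmetric])
  ultimately have "2 * (2 * real n + 1) * integral {0..1} (\<lambda>x. ?L n x * ?L n x) = 2"
    using lower[of n "n + 1"] lower[of "n - 1" n] False by (simp add: mult.commute)
  then show ?thesis by (simp add: power2_eq_square field_simps)
qed

text \<open>Integration by parts yields \<open>1 / n\<close>, and the L2 norms of the neighbouring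
  polynomials yield another \<open>1 / sqrt n\<close>.\<close>

lemma shifted_legendre_coefficient_bound:
  fixes g g' :: "real \<Rightarrow> real"
  assumes g: "\<And>x. (g has_real_derivative g' x) (at x)" and g': "continuous_on UNIV g'"
    and M: "\<And>x. x \<in> {0..1} \<Longrightarrow> \<bar>g' x\<bar> \<le> M" and "n \<ge> 1"
  shows "\<bar>integral {0..1} (\<lambda>x. g x * poly (shifted_legendre n) x)\<bar> \<le> M / (real n * sqrt (real n))"
proof -
  have "M \<ge> 0" using M[of 0] by auto
  have I: "\<bar>integral {0..1} (\<lambda>x. g' x * poly (shifted_legendre k) x)\<bar> \<le> M / sqrt (real n)" if "k \<ge> n - 1" for k
  proof -
    have "\<bar>integral {0..1} (\<lambda>x. g' x * poly (shifted_legendre k) x)\<bar> \<le> M * sqrt (1 / (2 * real k + 1))"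
      unfolding integral_shifted_legendre_squared[symmetric]
      by (intro integral_mult_bound continuous_on_subset[OF g'] continuous_on_poly_real M) auto
    \<comment> \<open>From \<open>k \<ge> n - 1\<close> and \<open>n \<ge> 1\<close>:
      \<open>2 * k + 1 \<ge> 2 * n - 1 \<ge> n\<close>.\<close>
    also have "\<dots> \<le> M * (1 / sqrt (real n))"
      unfolding real_sqrt_divide real_sqrt_one
      using that \<open>n \<ge> 1\<close> \<open>M \<ge> 0\<close> by (intro mult_left_mono frac_le) auto
    finally show ?thesis by simp
  qed
  have "2 * (2 * real n + 1) * \<bar>integral {0..1} (\<lambda>x. g x * poly (shifted_legendre n) x)\<bar> =
      \<bar>2 * (2 * real n + 1) * integral {0..1} (\<lambda>x. g x * poly (shifted_legendre n) x)\<bar>"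
    by (simp add: abs_mult)
  also have "\<dots> \<le> 2 * (M / sqrt (real n))"
    using I[of "n + 1"] I[of "n - 1"] unfolding integral_mult_shifted_legendre[OF g g' \<open>n \<ge> 1\<close>] by linarith
  finally have "(2 * real n + 1) * \<bar>integral {0..1} (\<lambda>x. g x * poly (shifted_legendre n) x)\<bar> \<le> M / sqrt (real n)"
    by linarith
  moreover have "real n * \<bar>integral {0..1} (\<lambda>x. g x * poly (shifted_legendre n) x)\<bar> \<le>
      (2 * real n + 1) * \<bar>integral {0..1} (\<lambda>x. g x * poly (shifted_legendre n) x)\<bar>"
    by (intro mult_right_mono) auto
  ultimately have "real n * \<bar>integral {0..1} (\<lambda>x. g x * poly (shifted_legendre n) x)\<bar> \<le> M / sqrt (real n)"
    by linarith
  then show ?thesis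
    using \<open>n \<ge> 1\<close> by (simp add: field_simps)
qed

text \<open>The reproducing kernel at the right endpoint is an exact derivative, so the projection error
  there needs no completeness argument.\<close>

lemma sum_shifted_legendre:
  "(\<Sum>n<Suc N. smult ((2 * real n + 1) * (-1) ^ n) (shifted_legendre n)) =
     pderiv (smult ((-1) ^ N / 2) (shifted_legendre N - shifted_legendre (N + 1)))"
proof (induction N)
  case 0
  show ?case using shifted_legendre_1 by (simp add: shifted_legendre_0 pderiv_smult pderiv_diff pderiv_pCons)
next
  case (Suc N)
  have "smult ((2 * real (Suc N) + 1) * (-1) ^ Suc N) (shifted_legendre (Suc N)) =
      smult ((-1) ^ Suc N / 2) (pderiv (shifted_legendre N) - pderiv (shifted_legendre (N + 2)))"
    unfolding pderiv_shifted_legendre by (simp add: algebra_simps)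
  then show ?case
    unfolding sum.lessThan_Suc[of _ "Suc N"] Suc
    by (simp add: pderiv_smult pderiv_diff pderiv_minus poly_eq_iff algebra_simps)
qed

text \<open>Integrating by parts against the antiderivative \<open>q\<close> of the reproducing
  kernel yields \<open>f 1\<close> exactly; the error is half a difference of two coefficients of
  \<open>f'\<close>, each of order \<open>N\<close> to the power \<open>-3/2\<close>.\<close>

lemma legendre_projection_error:
  fixes f f' f'' :: "real \<Rightarrow> real"
  assumes f: "\<And>x. (f has_real_derivative f' x) (at x)" and f': "\<And>x. (f' has_real_derivative f'' x) (at x)"
    and f'': "continuous_on UNIV f''" and M: "\<And>x. x \<in> {0..1} \<Longrightarrow> \<bar>f'' x\<bar> \<le> M" and "N \<ge> 1"
  shows "\<bar>integral {0..1} (\<lambda>x. f x * poly (\<Sum>n<Suc N. smult ((2 * real n + 1) * (-1) ^ n) (shifted_legendre n)) x)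
            - f 1\<bar> \<le> M / (real N * sqrt (real N))"
proof -
  have "M \<ge> 0" using M[of 0] by auto
  define q where "q = smult ((-1) ^ N / 2) (shifted_legendre N - shifted_legendre (N + 1))"
  let ?I = "\<lambda>n. integral {0..1} (\<lambda>x. f' x * poly (shifted_legendre n) x)"
  have cf': "continuous_on S f'" for S
    by (rule has_real_derivative_imp_continuous_on[OF f'])
  have "integral {0..1} (\<lambda>x. f x * poly (pderiv q) x) =
      f 1 * poly q 1 - f 0 * poly q 0 - integral {0..1} (\<lambda>x. f' x * poly q x)"
    by (intro integral_parts f cf' poly_DERIV continuous_on_poly_real) auto
  moreover have "poly q 0 = 0" "poly q 1 = 1"
    by (simp_all add: q_def shifted_legendre_at_0 shifted_legendre_at_1 power_add[symmetric] mult_2[symmetric])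
  moreover have "integral {0..1} (\<lambda>x. f' x * poly q x) = (-1) ^ N / 2 * (?I N - ?I (N + 1))"
  proof -
    have "integral {0..1} (\<lambda>x. f' x * poly q x) = integral {0..1} (\<lambda>x. (-1) ^ N / 2 *
        (f' x * poly (shifted_legendre N) x - f' x * poly (shifted_legendre (N + 1)) x))"
      by (simp add: q_def algebra_simps)
    also have "\<dots> = (-1) ^ N / 2 * integral {0..1} (\<lambda>x.
        f' x * poly (shifted_legendre N) x - f' x * poly (shifted_legendre (N + 1)) x)"
      by (rule integral_mult_right)
    also have "integral {0..1} (\<lambda>x. f' x * poly (shifted_legendre N) x - f' x * poly (shifted_legendre (N + 1)) x) =
        ?I N - ?I (N + 1)"
      by (intro Henstock_Kurzweil_Integration.integral_diff integrable_continuous_real continuous_intros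
          continuous_on_poly_real cf')
    finally show ?thesis .
  qed
  ultimately have "\<bar>integral {0..1} (\<lambda>x. f x * poly (pderiv q) x) - f 1\<bar> = \<bar>?I N - ?I (N + 1)\<bar> / 2"
    by (simp add: abs_mult)
  also have "\<dots> \<le> (\<bar>?I N\<bar> + \<bar>?I (N + 1)\<bar>) / 2"
    by (simp add: abs_triangle_ineq4)
  also have "\<dots> \<le> M / (real N * sqrt (real N))"
  proof -
    have N: "\<bar>?I N\<bar> \<le> M / (real N * sqrt (real N))"
      by (intro shifted_legendre_coefficient_bound[where g' = f''] f' f'' M \<open>N \<ge> 1\<close>)
    have "\<bar>?I (N + 1)\<bar> \<le> M / (real (N + 1) * sqrt (real (N + 1)))"
      by (intro shifted_legendre_coefficient_bound[where g' = f''] f' f'' M) auto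
    moreover have "M / (real (N + 1) * sqrt (real (N + 1))) \<le> M / (real N * sqrt (real N))"
      using \<open>N \<ge> 1\<close> \<open>M \<ge> 0\<close> by (intro divide_left_mono mult_mono) auto
    ultimately have "\<bar>?I (N + 1)\<bar> \<le> M / (real N * sqrt (real N))"
      by (rule order_trans)
    moreover have "(a + b) / 2 \<le> c" if "a \<le> c" "b \<le> c" for a b c :: real
      using that by simp
    ultimately show ?thesis using N by blast
  qed
  finally show ?thesis unfolding sum_shifted_legendre q_def .
qed

section \<open>The Legendre system as transport with feedback\<close>

text \<open>The differentiation matrix of the normalised basis, strictly lower triangular because
  derivatives lower the degree.\<close>

definition legt_D :: "nat \<Rightarrow> nat \<Rightarrow> real" where
  "legt_D n k =
     (if k < n then sqrt (2 * real n + 1) * sqrt (2 * real k + 1) * ((-1) ^ (n + k) - 1) else 0)"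

lemma legt_basis_at_0: "legt_basis n 0 = sqrt (2 * real n + 1)"
  by (simp add: legt_basis_eq shifted_legendre_at_0)

lemma legt_basis_at_1: "legt_basis n 1 = sqrt (2 * real n + 1) * (-1) ^ n"
  by (simp add: legt_basis_eq shifted_legendre_at_1)

lemma sign_cancel: "(a * (-1) ^ j) * (b * (-1) ^ j) = (a * b :: real)"
proof -
  have "(-1 :: real) ^ j * (-1) ^ j = 1" by (simp flip: power_mult_distrib)
  moreover have "(a * (-1) ^ j) * (b * (-1) ^ j) = a * b * ((-1) ^ j * (-1) ^ j)" by (simp only: mult_ac)
  ultimately show ?thesis by simp
qed

text \<open>Below the diagonal the alternating sign of \<open>legt_D\<close> cancels against the
  feedback and leaves \<open>-1\<close>; on and above it only the feedback remains, and
  \<open>(-1) ^ (n + k)\<close> equals \<open>(-1) ^ (k - n)\<close>.\<close>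

lemma legt_A_eq:
  assumes "n < N" "k < N"
  shows "legt_A N $$ (n, k) = legt_D n k - legt_basis n 1 * legt_basis k 1"
proof -
  consider "k < n" | "k = n" | "n < k" by linarith
  then show ?thesis
  proof cases
    case 1
    then show ?thesis
      using assms by (simp add: legt_A_def legt_D_def legt_basis_at_1 power_add algebra_simps)
  next
    case 2
    then show ?thesis
      using assms by (simp add: legt_A_def legt_D_def legt_basis_at_1 sign_cancel)
  next
    case 3
    have "legt_basis n 1 * legt_basis k 1 =
        (sqrt (2 * real n + 1) * (-1) ^ n) * ((sqrt (2 * real k + 1) * (-1) ^ (k - n)) * (-1) ^ n)"
      using 3 by (simp add: legt_basis_at_1 mult.assoc flip: power_add)
    also have "\<dots> = sqrt (2 * real n + 1) * (sqrt (2 * real k + 1) * (-1) ^ (k - n))"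
      by (rule sign_cancel)
    finally show ?thesis
      using assms 3 by (simp add: legt_A_def legt_D_def)
  qed
qed

lemma legt_D_skew:
  "legt_D n k + legt_D k n = legt_basis n 1 * legt_basis k 1 - legt_basis n 0 * legt_basis k 0"
proof (cases "n = k")
  case True
  then show ?thesis by (simp add: legt_D_def legt_basis_at_1 legt_basis_at_0 sign_cancel)
next
  case False
  then consider "k < n" | "n < k" by linarith
  then show ?thesis
    by cases (simp_all add: legt_D_def legt_basis_at_1 legt_basis_at_0 power_add algebra_simps)
qed

lemma has_derivative_legt_basis:
  assumes "n < N"
  shows "(legt_basis n has_real_derivative (\<Sum>k<N. legt_D n k * legt_basis k t)) (at t)"
proof -
  have "((\<lambda>t. sqrt (2 * real n + 1) * poly (shifted_legendre n) t) has_real_derivative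
      sqrt (2 * real n + 1) * poly (pderiv (shifted_legendre n)) t) (at t)"
    by (intro DERIV_cmult poly_DERIV)
  also have "sqrt (2 * real n + 1) * poly (pderiv (shifted_legendre n)) t =
      (\<Sum>k<n. legt_D n k * legt_basis k t)"
    unfolding pderiv_shifted_legendre_sum poly_sum sum_distrib_left
  proof (intro sum.cong refl)
    fix k assume "k \<in> {..<n}"
    moreover have "sqrt (2 * real k + 1) * (sqrt (2 * real k + 1) * x) = (2 * real k + 1) * x" for x
      by (simp add: mult.assoc[symmetric])
    ultimately show "sqrt (2 * real n + 1) *
        poly (smult ((2 * real k + 1) * ((-1) ^ (n + k) - 1)) (shifted_legendre k)) t = legt_D n k * legt_basis k t"
      by (simp add: legt_D_def legt_basis_eq mult_ac)
  qed
  \<comment> \<open>Polynomials of degree below \<open>N\<close> are closed under differentiation,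
    so every size \<open>N\<close> is admissible here.\<close>
  also have "\<dots> = (\<Sum>k<N. legt_D n k * legt_basis k t)"
    using assms by (intro sum.mono_neutral_left) (auto simp: legt_D_def)
  finally show ?thesis by (simp add: legt_basis_eq[abs_def])
qed

lemma sum_legt_basis:
  "(\<Sum>n<N. legt_basis n 1 * legt_basis n t) =
     poly (\<Sum>n<N. smult ((2 * real n + 1) * (-1) ^ n) (shifted_legendre n)) t"
proof -
  have "sqrt (2 * real k + 1) * (sqrt (2 * real k + 1) * x) = (2 * real k + 1) * x" for x k
    by (simp add: mult.assoc[symmetric])
  then show ?thesis
    unfolding poly_sum legt_basis_at_1 by (simp add: legt_basis_eq mult_ac)
qed

lemma sum_legt_C: "(\<Sum>n<N. (legt_C N $ n)\<^sup>2) = (real N)\<^sup>2"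
proof -
  have "(\<Sum>n<N. (legt_C N $ n)\<^sup>2) = (\<Sum>n<N. 2 * real n + 1)"
    by (simp add: legt_C_def legt_basis_at_1 power_mult_distrib flip: power_mult)
  also have "\<dots> = (real N)\<^sup>2"
    by (induction N) (simp_all add: power2_eq_square algebra_simps)
  finally show ?thesis .
qed

theorem legt_kernel_tendsto:
  "distr_tendsto (\<lambda>N. ssm_kernel (legt_A N) (legt_B N) (legt_C N) 0) (dirac 1)"
  unfolding distr_tendsto_def
proof (intro allI impI)
  fix \<phi> assume "test_function \<phi>"
  then obtain \<phi>' \<phi>'' T M where \<phi>: "\<And>x. (\<phi> has_real_derivative \<phi>' x) (at x)"
    "\<And>x. (\<phi>' has_real_derivative \<phi>'' x) (at x)" "continuous_on UNIV \<phi>''"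
    "T > 0" "\<And>x. x \<ge> T \<Longrightarrow> \<phi> x = 0" "\<And>x. x \<in> {0..T + 1} \<Longrightarrow> \<bar>\<phi>'' x\<bar> \<le> M"
    by (rule test_function_derivs) blast
  \<comment> \<open>The projection error is stated for \<open>Suc m\<close> basis functions, hence
    \<open>N = Suc m\<close>; \<open>1 - 1\<close> matches \<open>kernel_error\<close> at
    \<open>\<kappa> = 1\<close>.\<close>
  have err: "\<bar>ssm_kernel (legt_A N) (legt_B N) (legt_C N) (1 - 1) \<phi> - \<phi> 1\<bar> \<le>
      M / (real m * sqrt (real m)) * (1 + sqrt (T * (\<Sum>n<N. (legt_C N $ n)\<^sup>2)))"
    if m: "m \<ge> 1" and N: "N = Suc m" for m N
  proof (rule kernel_error[where d = legt_D and p = legt_basis and \<phi>' = \<phi>'])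
    fix s assume s: "s \<in> {0..T}"
    have c: "continuous_on S \<phi>" "continuous_on S (legt_basis n)" for n S
      using has_real_derivative_imp_continuous_on[OF \<phi>(1)]
        has_real_derivative_imp_continuous_on[OF has_derivative_legt_basis[of n "Suc n"]] by auto
    have "integral {0..1} (\<lambda>\<theta>. \<phi> (s + \<theta>) * (\<Sum>n<N. legt_basis n 1 * legt_basis n \<theta>)) =
        integral {0..1} (\<lambda>\<theta>. \<Sum>n<N. legt_basis n 1 * (\<phi> (s + \<theta>) * legt_basis n \<theta>))"
      by (simp only: sum_distrib_left mult_ac)
    also have "\<dots> = (\<Sum>n<N. integral {0..1} (\<lambda>\<theta>. legt_basis n 1 * (\<phi> (s + \<theta>) * legt_basis n \<theta>)))"
      by (intro integral_sum integrable_continuous_real continuous_intros c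
          continuous_on_compose2[OF c(1)[of UNIV]]) auto
    finally have "(\<Sum>n<N. legt_basis n 1 * integral {0..1} (\<lambda>\<theta>. \<phi> (s + \<theta>) * legt_basis n \<theta>)) =
        integral {0..1} (\<lambda>\<theta>. \<phi> (s + \<theta>) * (\<Sum>n<N. legt_basis n 1 * legt_basis n \<theta>))"
      by simp
    moreover have "\<bar>integral {0..1} (\<lambda>\<theta>. \<phi> (s + \<theta>) * (\<Sum>n<N. legt_basis n 1 * legt_basis n \<theta>)) - \<phi> (s + 1)\<bar>
        \<le> M / (real m * sqrt (real m))"
      unfolding sum_legt_basis N using s \<phi>(6) m
      by (intro legendre_projection_error[where f' = "\<lambda>x. \<phi>' (s + x)" and f'' = "\<lambda>x. \<phi>'' (s + x)"]
          has_real_derivative_shift \<phi> continuous_on_compose2[OF \<phi>(3)] continuous_intros) auto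
    ultimately show "\<bar>1 * (\<Sum>n<N. legt_basis n 1 * integral {0..1} (\<lambda>\<theta>. \<phi> (s + \<theta>) * legt_basis n \<theta>)) -
        \<phi> (s + 1) - (1 - 1) * \<phi> s\<bar> \<le> M / (real m * sqrt (real m))"
      by simp
  next
    fix n k assume "n < N" "k < N"
    then show "legt_A N $$ (n, k) = legt_D n k - 1 * legt_basis n 1 * legt_basis k 1"
      by (simp add: legt_A_eq)
    show "legt_D n k + legt_D k n = legt_basis n 1 * legt_basis k 1 - legt_basis n 0 * legt_basis k 0"
      by (rule legt_D_skew)
  qed (use \<phi> has_derivative_legt_basis in
      \<open>auto simp: legt_A_def legt_B_def legt_C_def legt_basis_at_0
        intro: has_real_derivative_imp_continuous_on\<close>)
  \<comment> \<open>Here \<open>|C|\<close> is \<open>Suc m\<close>, so the product is of order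
    \<open>1 / sqrt m\<close>.\<close>
  have lim: "(\<lambda>m. M / (real m * sqrt (real m)) * (1 + sqrt (T * (real (Suc m))\<^sup>2))) \<longlonglongrightarrow> 0"
  proof -
    have "(\<lambda>m. 1 / (real m * sqrt (real m)) * (1 + sqrt (T * (real (Suc m))\<^sup>2))) \<longlonglongrightarrow> 0"
      using \<open>T > 0\<close> by real_asymp
    from tendsto_mult_right_zero[OF this, of M] show ?thesis by simp
  qed
  have "(\<lambda>m. ssm_kernel (legt_A (Suc m)) (legt_B (Suc m)) (legt_C (Suc m)) 0 \<phi> - \<phi> 1) \<longlonglongrightarrow> 0"
  proof (rule Lim_null_comparison[OF _ lim])
    show "\<forall>\<^sub>F m in sequentially.
        norm (ssm_kernel (legt_A (Suc m)) (legt_B (Suc m)) (legt_C (Suc m)) 0 \<phi> - \<phi> 1)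
        \<le> M / (real m * sqrt (real m)) * (1 + sqrt (T * (real (Suc m))\<^sup>2))"
      using eventually_ge_at_top[of 1]
    proof eventually_elim
      case (elim m)
      then show ?case using err[OF elim refl] unfolding sum_legt_C by simp
    qed
  qed
  then show "(\<lambda>N. ssm_kernel (legt_A N) (legt_B N) (legt_C N) 0 \<phi>) \<longlonglongrightarrow> dirac 1 \<phi>"
    unfolding dirac_def by (rule LIMSEQ_imp_Suc[OF LIM_zero_cancel])
qed

(* The Fourier system is taken at the sizes N = 2m + 1, where every cosine is paired with its
   sine. At even sizes the last cosine is unpaired and the kernels do not tend to the delta at 1. *)
theorem theorem8:
  shows "distr_tendsto
           (\<lambda>m. ssm_kernel (fout_A (2 * m + 1)) (fout_B (2 * m + 1)) (fout_C (2 * m + 1)) (-1))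
           (dirac 1)
         \<and> (\<forall>n. legt_basis n 1 = sqrt (1 + 2 * real n) * (-1) ^ n)
         \<and> distr_tendsto (\<lambda>N. ssm_kernel (legt_A N) (legt_B N) (legt_C N) 0) (dirac 1)"
  using fout_kernel_tendsto legt_kernel_tendsto by (simp add: legt_basis_at_1 add.commute)

end
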